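(* Let $t\in\mathbb{T}$, $\rho>0$, $K>0$, and let $\phi(x)=\exp\{-x^{-\rho}\}$ for $x>0$, $\phi(0)=0$. Let $B$ be a Blaschke product whose zero set satisfies $Z(B)\subset\mathcal{S}_\phi(t,K)$, and let $\{z_n'\}=Z(B')$ be the zeros of $B'$ in $\mathbb{D}$. Then $$\sum_{n=1}^\infty (1-|z_n'|)\,|t-z_n'|^{(\rho-1+\varepsilon)_+}<\infty\qquad\text{for all }\varepsilon>0,$$ where $(a)_+=\max(a,0)$.
   Context: $\mathbb{D}$ is the open unit disk in $\mathbb{C}$ and $\mathbb{T}$ the unit circle. Blaschke product: for a sequence $\{z_n\}_{n\ge1}\subset\mathbb{D}$ (repetitions allowed) with $\sum_{n=1}^\infty(1-|z_n|)<\infty$, $$B(z)=\prod_{n=1}^\infty b_n(z),\qquad b_n(z)=\frac{\overline{z_n}}{|z_n|}\,\frac{z_n-z}{1-\overline{z_n}z},$$ and $Z(B)=\{z_n\}$ is its zero set. Standing assumption: $B(0)\neq0$, i.e. all $z_n\ne0$. Zeros of $B'$ are listed with multiplicity; the sum is over all of them (there may be finitely many). Stolz angle associated with $\phi$ with vertex $t\in\mathbb{T}$: for $K>0$, $\mathcal{S}_\phi(t,K)=\{\lambda\in\mathbb{D}:\ \phi(|t-\lambda|)\le K(1-|\lambda|)\}$. *)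

theory Defs
  imports "HOL-Complex_Analysis.Complex_Analysis"
begin

definition blaschke_seq :: "(nat \<Rightarrow> complex) \<Rightarrow> bool" where
  "blaschke_seq a \<longleftrightarrow>
     (\<forall>n. a n \<in> ball 0 1 \<and> a n \<noteq> 0) \<and> summable (\<lambda>n. 1 - cmod (a n))"

definition blaschke_factor :: "complex \<Rightarrow> complex \<Rightarrow> complex" where
  "blaschke_factor w z =
     cnj w / complex_of_real (cmod w) * ((w - z) / (1 - cnj w * z))"

text \<open>The library product \<^const>\<open>prodinf\<close> takes the value \<open>0\<close> when finitely many factors vanish
  and the product of the remaining ones converges, so this is the usual product also at the
  points \<open>a n\<close>. It is meaningful on the open unit disk only.\<close>

definition blaschke_prod :: "(nat \<Rightarrow> complex) \<Rightarrow> complex \<Rightarrow> complex" where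
  "blaschke_prod a z = (\<Prod>n. blaschke_factor (a n) z)"

definition stolz_angle :: "(real \<Rightarrow> real) \<Rightarrow> complex \<Rightarrow> real \<Rightarrow> complex set" where
  "stolz_angle \<phi> t K = {w \<in> ball 0 1. \<phi> (cmod (t - w)) \<le> K * (1 - cmod w)}"

definition exp_gauge :: "real \<Rightarrow> real \<Rightarrow> real" where
  "exp_gauge \<rho> x = (if x > 0 then exp (- (x powr (- \<rho>))) else 0)"

definition disk_zeros :: "(complex \<Rightarrow> complex) \<Rightarrow> complex set" where
  "disk_zeros f = {z \<in> ball 0 1. f z = 0}"

end

theory Submission
  imports Defs
begin

text \<open>
  Put \<open>f = B'\<close>. The proof compares two facts about \<open>f\<close>: it does not grow too fast near \<open>t\<close>,
  and a function that grows slowly cannot have too many zeros.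

  Growth. Termwise differentiation bounds \<open>\<bar>f z\<bar>\<close> by a constant times
  \<open>\<Sum>n. (1 - \<bar>a n\<bar>) / \<bar>1 - cnj (a n) * z\<bar>\<^sup>2\<close>. The denominators are at least
  \<open>1 - \<bar>a n\<bar>\<close> and at least \<open>\<bar>a n - z\<bar>\<close>. If \<open>a n\<close> is not much closer to \<open>t\<close> than \<open>z\<close> is, the
  Stolz condition makes the first of these at least of the order of \<open>\<phi> (\<bar>t - z\<bar> / 2)\<close>; otherwise
  the second is at least \<open>\<bar>t - z\<bar> / 2\<close> (\<open>stolz_angle_separation\<close>). Hence
  \<open>\<bar>f z\<bar> \<le> exp (A * \<bar>t - z\<bar> powr - \<rho>)\<close> (\<open>deriv_blaschke_prod_growth\<close>).

  Zeros. Under \<open>v = (t + z) / (t - z)\<close> the disc becomes the right half-plane, \<open>t\<close> goes to infinity,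
  and the bound becomes order \<open>\<rho>\<close> growth, \<open>\<bar>g v\<bar> \<le> exp (A * \<bar>v + 1\<bar> powr \<rho>)\<close>. Fix
  \<open>0 < \<sigma> < 1\<close> with \<open>\<sigma> \<le> \<rho>\<close>. In the half-disc \<open>\<bar>v\<bar> \<le> 4 * R\<close> the exponent
  is at most a constant times \<open>R powr (\<rho> - \<sigma>) * \<bar>v + 1\<bar> powr \<sigma>\<close>, and because \<open>\<sigma> < 1\<close> the
  function \<open>Re ((v + 1) powr \<sigma>)\<close> is a harmonic majorant of a multiple of \<open>\<bar>v + 1\<bar> powr \<sigma>\<close>. So
  multiplying \<open>g\<close> by an explicit exponential makes it bounded by 1 in the half-disc, at the cost of a
  factor \<open>exp (- C * R powr (\<rho> - \<sigma>))\<close> at the base point. Dividing out the zeros by the Blaschke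
  factors of the half-disc and applying the maximum principle (\<open>half_disc_max_principle\<close>) gives
  a Jensen-type inequality (\<open>half_plane_zeros_sum_le\<close>), which reads in the disc
  (\<open>disk_zeros_away_from_vertex\<close>): the sum of \<open>1 - \<bar>p\<bar>\<close> over the zeros with \<open>\<bar>t - p\<bar> \<ge> \<delta>\<close> is at
  most \<open>C * \<delta> powr - (\<rho> - \<sigma>)\<close>.

  Summation. If \<open>\<rho> < 1\<close>, the choice \<open>\<sigma> = \<rho>\<close> bounds all these sums uniformly in \<open>\<delta>\<close>.
  If \<open>\<rho> \<ge> 1\<close>, let \<open>\<sigma>\<close> be so close to 1 that \<open>\<rho> - \<sigma> < \<rho> - 1 + \<epsilon>\<close>; splitting the zeros
  according to the dyadic size of \<open>\<bar>t - p\<bar>\<close> then gives a convergent geometric series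
  (\<open>weighted_sum_le_of_tail_sums\<close>).
\<close>

section \<open>Growth of the derivative of a Blaschke product\<close>

lemma one_minus_cnj_mult_nonzero:
  assumes "cmod w < 1" "cmod z \<le> 1"
  shows "1 - cnj w * z \<noteq> 0"
proof
  assume "1 - cnj w * z = 0"
  then have "cmod w * cmod z = 1"
    by (metis complex_mod_cnj eq_iff_diff_eq_0 norm_mult norm_one)
  moreover have "cmod w * cmod z \<le> cmod w * 1"
    using assms by (intro mult_left_mono) auto
  ultimately show False using assms by linarith
qed

lemma norm_diff_le_norm_one_minus_cnj_mult:
  assumes "cmod w \<le> 1" "cmod z \<le> 1"
  shows "cmod (w - z) \<le> cmod (1 - cnj w * z)"
proof (rule power2_le_imp_le)
  have "(cmod (1 - cnj w * z))\<^sup>2 - (cmod (w - z))\<^sup>2 = (1 - (cmod w)\<^sup>2) * (1 - (cmod z)\<^sup>2)"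
    unfolding cmod_power2 by (simp add: power2_eq_square algebra_simps)
  moreover have "\<dots> \<ge> 0"
    using assms by (intro mult_nonneg_nonneg) (auto simp: power_le_one)
  ultimately show "(cmod (w - z))\<^sup>2 \<le> (cmod (1 - cnj w * z))\<^sup>2" by linarith
qed simp

lemma norm_one_minus_cnj_mult_ge:
  assumes "cmod z \<le> 1"
  shows "1 - cmod w \<le> cmod (1 - cnj w * z)"
proof -
  have "cmod w * cmod z \<le> cmod w"
    using assms by (simp add: mult_left_le)
  then have "1 - cmod w \<le> cmod 1 - cmod (cnj w * z)"
    by (simp add: norm_mult)
  also have "\<dots> \<le> cmod (1 - cnj w * z)" by (rule norm_triangle_ineq2)
  finally show ?thesis .
qed

lemma norm_blaschke_factor_le_1:
  assumes "cmod w < 1" "cmod z \<le> 1"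
  shows "cmod (blaschke_factor w z) \<le> 1"
proof -
  have "cmod ((w - z) / (1 - cnj w * z)) \<le> 1"
    using norm_diff_le_norm_one_minus_cnj_mult[of w z] one_minus_cnj_mult_nonzero[OF assms] assms
    by (simp add: norm_divide divide_simps)
  then show ?thesis
    by (cases "w = 0") (auto simp: blaschke_factor_def norm_mult norm_divide)
qed

lemma norm_blaschke_factor_minus_1_le:
  assumes "w \<noteq> 0" "cmod w < 1" "cmod z < 1"
  shows "cmod (blaschke_factor w z - 1) \<le> (1 - cmod w) * (2 / (1 - cmod z))"
proof -
  let ?d = "1 - cnj w * z"
  let ?r = "complex_of_real (cmod w)"
  have nz: "?d \<noteq> 0" using one_minus_cnj_mult_nonzero assms by simp
  have r: "?r \<noteq> 0" using assms by simp
  have sq: "cnj w * w = ?r * ?r"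
    using complex_norm_square[of w] by (simp add: power2_eq_square mult.commute)
  have "cnj w * (w - z) - ?r * ?d = - (1 - ?r) * (?r + cnj w * z)"
    using sq by (simp add: algebra_simps)
  then have eq: "blaschke_factor w z - 1 = - (1 - ?r) * (?r + cnj w * z) / (?r * ?d)"
    using nz r by (simp add: blaschke_factor_def divide_simps)
  have num: "cmod (?r + cnj w * z) \<le> cmod w * 2"
  proof -
    have "cmod (?r + cnj w * z) \<le> cmod w + cmod w * cmod z"
      using norm_triangle_ineq[of ?r "cnj w * z"] by (simp add: norm_mult)
    also have "\<dots> \<le> cmod w * 2" using assms by (simp add: mult_left_le)
    finally show ?thesis .
  qed
  have den: "1 - cmod z \<le> cmod ?d"
    using norm_one_minus_cnj_mult_ge[of "cnj w" "cnj z"] assms by (simp add: mult.commute)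
  have "cmod (1 - ?r) = 1 - cmod w"
    using norm_of_real[of "1 - cmod w", where ?'a = complex] assms by simp
  then have "cmod (blaschke_factor w z - 1) = (1 - cmod w) * cmod (?r + cnj w * z) / (cmod w * cmod ?d)"
    unfolding eq by (simp add: norm_mult norm_divide norm_minus_commute)
  also have "\<dots> \<le> (1 - cmod w) * (cmod w * 2) / (cmod w * (1 - cmod z))"
    using assms num den by (intro frac_le mult_mono mult_pos_pos) auto
  also have "\<dots> = (1 - cmod w) * (2 / (1 - cmod z))" using assms by simp
  finally show ?thesis .
qed

lemma has_field_derivative_blaschke_factor:
  assumes "1 - cnj w * z \<noteq> 0"
  shows "(blaschke_factor w has_field_derivative
           cnj w / of_real (cmod w) * (of_real ((cmod w)\<^sup>2) - 1) / (1 - cnj w * z)\<^sup>2) (at z)"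
  unfolding blaschke_factor_def[abs_def] complex_norm_square
  by (rule derivative_eq_intros refl assms)+
     (use assms in \<open>auto simp: field_simps power2_eq_square\<close>)

lemma holomorphic_blaschke_factor:
  assumes "cmod w < 1"
  shows "blaschke_factor w holomorphic_on ball 0 1"
  unfolding holomorphic_on_open[OF open_ball]
proof
  fix z :: complex assume "z \<in> ball 0 1"
  then have "1 - cnj w * z \<noteq> 0" using one_minus_cnj_mult_nonzero[OF assms] by simp
  from has_field_derivative_blaschke_factor[OF this]
  show "\<exists>d. (blaschke_factor w has_field_derivative d) (at z)" ..
qed

lemma norm_deriv_blaschke_factor_le:
  assumes "cmod w < 1" "cmod z < 1"
  shows "cmod (deriv (blaschke_factor w) z) \<le> 2 * (1 - cmod w) / (cmod (1 - cnj w * z))\<^sup>2"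
proof -
  have nz: "1 - cnj w * z \<noteq> 0" using one_minus_cnj_mult_nonzero assms by simp
  have "cmod (of_real ((cmod w)\<^sup>2) - 1) = 1 - (cmod w)\<^sup>2"
    using assms
      norm_of_real[of "(cmod w)\<^sup>2 - 1", where ?'a = complex]
    by (simp add: power_le_one)
  also have "\<dots> = (1 + cmod w) * (1 - cmod w)" by (simp add: power2_eq_square algebra_simps)
  also have "\<dots> \<le> 2 * (1 - cmod w)" using assms by (intro mult_right_mono) auto
  finally have *: "cmod (of_real ((cmod w)\<^sup>2) - 1) \<le> 2 * (1 - cmod w)" .
  have "cmod (cnj w / of_real (cmod w)) \<le> 1" by (simp add: norm_divide)
  then have "cmod (cnj w / of_real (cmod w)) * cmod (of_real ((cmod w)\<^sup>2) - 1) \<le> 1 * (2 * (1 - cmod w))"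
    using * assms by (intro mult_mono) auto
  then show ?thesis
    unfolding DERIV_imp_deriv[OF has_field_derivative_blaschke_factor[OF nz]]
      norm_mult norm_divide[of _ "_\<^sup>2"] norm_power
    by (intro divide_right_mono) auto
qed

text \<open>
  By \<open>norm_blaschke_factor_minus_1_le\<close> the factors differ from 1 by at most a constant times
  \<open>1 - \<bar>a n\<bar>\<close> on \<open>cball 0 r\<close>, so the product converges absolutely and uniformly there.
\<close>
lemma uniform_limit_blaschke_prod:
  assumes a: "blaschke_seq a" and r: "r < 1"
  shows "uniform_limit (cball 0 r) (\<lambda>N z. \<Prod>n<N. blaschke_factor (a n) z) (blaschke_prod a) sequentially"
proof -
  have an: "cmod (a n) < 1" "a n \<noteq> 0" for n
    using a by (auto simp: blaschke_seq_def)
  have sum: "summable (\<lambda>n. (1 - cmod (a n)) * (2 / (1 - r)))"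
    using a by (intro summable_mult2) (auto simp: blaschke_seq_def)
  have bound: "cmod (blaschke_factor (a n) z - 1) \<le> (1 - cmod (a n)) * (2 / (1 - r))"
    if "z \<in> cball 0 r" for n z
  proof -
    have "cmod (blaschke_factor (a n) z - 1) \<le> (1 - cmod (a n)) * (2 / (1 - cmod z))"
      using an that r by (intro norm_blaschke_factor_minus_1_le) auto
    also have "\<dots> \<le> (1 - cmod (a n)) * (2 / (1 - r))"
      using an[of n] that r by (intro mult_left_mono divide_left_mono mult_pos_pos) auto
    finally show ?thesis .
  qed
  have "uniformly_convergent_on (cball 0 r) (\<lambda>N z. \<Prod>n<N. blaschke_factor (a n) z)"
  proof (rule uniformly_convergent_on_prod')
    show "continuous_on (cball 0 r) (blaschke_factor (a n))" for n
      using an r by (intro continuous_on_subset[OF holomorphic_on_imp_continuous_on[OF holomorphic_blaschke_factor]]) auto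
    show "uniformly_convergent_on (cball 0 r) (\<lambda>N x. \<Sum>n<N. cmod (blaschke_factor (a n) x - 1))"
      by (rule Weierstrass_m_test'[OF _ sum]) (use bound in auto)
  qed simp
  then obtain l where l: "uniform_limit (cball 0 r) (\<lambda>N z. \<Prod>n<N. blaschke_factor (a n) z) l sequentially"
    by (auto simp: uniformly_convergent_on_def)
  have "l z = blaschke_prod a z" if z: "z \<in> cball 0 r" for z
  proof -
    have "summable (\<lambda>n. cmod (blaschke_factor (a n) z - 1))"
      by (rule summable_comparison_test'[OF sum, of 0]) (use bound[OF z] in auto)
    then have "convergent_prod (\<lambda>n. blaschke_factor (a n) z)"
      by (intro abs_convergent_prod_imp_convergent_prod) (simp add: abs_convergent_prod_conv_summable)
    from convergent_prod_LIMSEQ[OF this]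
    have "(\<lambda>N. \<Prod>n<N. blaschke_factor (a n) z) \<longlonglongrightarrow> blaschke_prod a z"
      by (simp add: blaschke_prod_def LIMSEQ_lessThan_iff_atMost)
    moreover have "(\<lambda>N. \<Prod>n<N. blaschke_factor (a n) z) \<longlonglongrightarrow> l z"
      using tendsto_uniform_limitI[OF l z] .
    ultimately show ?thesis using LIMSEQ_unique by blast
  qed
  then show ?thesis
    using l uniform_limit_cong'[of "cball 0 r" "\<lambda>N z. \<Prod>n<N. blaschke_factor (a n) z" "\<lambda>N z. \<Prod>n<N. blaschke_factor (a n) z" l "blaschke_prod a" sequentially]
    by auto
qed

lemma holomorphic_prod_blaschke_factor:
  assumes "blaschke_seq a"
  shows "(\<lambda>z. \<Prod>n\<in>S. blaschke_factor (a n) z) holomorphic_on ball 0 1"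
  using assms by (intro holomorphic_on_prod holomorphic_blaschke_factor) (auto simp: blaschke_seq_def)

lemma holomorphic_blaschke_prod:
  assumes a: "blaschke_seq a"
  shows "blaschke_prod a holomorphic_on ball 0 1"
proof (rule holomorphic_uniform_sequence[OF open_ball holomorphic_prod_blaschke_factor[OF a, of "{..<n}" for n]])
  fix x :: complex assume x: "x \<in> ball 0 1"
  define d where "d = (1 - cmod x) / 2"
  have sub: "cball x d \<subseteq> cball 0 ((1 + cmod x) / 2)"
  proof
    fix y assume "y \<in> cball x d"
    then have "cmod (x - y) \<le> d" by (simp add: dist_norm)
    moreover have "cmod y \<le> cmod x + cmod (x - y)"
      by (metis norm_minus_commute norm_triangle_sub add.commute)
    ultimately show "y \<in> cball 0 ((1 + cmod x) / 2)" by (simp add: d_def field_simps)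
  qed
  have "uniform_limit (cball x d) (\<lambda>N z. \<Prod>n<N. blaschke_factor (a n) z) (blaschke_prod a) sequentially"
    by (rule uniform_limit_on_subset[OF uniform_limit_blaschke_prod[OF a] sub]) (use x in auto)
  moreover have "cball x d \<subseteq> ball 0 1" using sub x by force
  ultimately show "\<exists>d>0. cball x d \<subseteq> ball 0 1 \<and>
      uniform_limit (cball x d) (\<lambda>N z. \<Prod>n<N. blaschke_factor (a n) z) (blaschke_prod a) sequentially"
    using x by (intro exI[of _ d]) (auto simp: d_def)
qed

lemma blaschke_prod_at_zero: "blaschke_prod a (a k) = 0" if a: "blaschke_seq a"
proof -
  have "cmod (a k) < 1" using a by (simp add: blaschke_seq_def)
  then have lim: "(\<lambda>N. \<Prod>n<N. blaschke_factor (a n) (a k)) \<longlonglongrightarrow> blaschke_prod a (a k)"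
    by (intro tendsto_uniform_limitI[OF uniform_limit_blaschke_prod[OF a]]) auto
  have "eventually (\<lambda>N. (\<Prod>n<N. blaschke_factor (a n) (a k)) = 0) sequentially"
    using eventually_gt_at_top[of k]
    by eventually_elim (auto simp: blaschke_factor_def)
  then have "(\<lambda>N. \<Prod>n<N. blaschke_factor (a n) (a k)) \<longlonglongrightarrow> 0"
    by (rule tendsto_eventually)
  with lim show ?thesis using LIMSEQ_unique by blast
qed

lemma blaschke_prod_0_nonzero: "blaschke_prod a 0 \<noteq> 0" if a: "blaschke_seq a"
proof -
  have an: "cmod (a n) < 1" "a n \<noteq> 0" for n
    using a by (auto simp: blaschke_seq_def)
  have sum: "summable (\<lambda>n. (1 - cmod (a n)) * 2)"
    using a by (intro summable_mult2) (auto simp: blaschke_seq_def)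
  have "cmod (blaschke_factor (a n) 0 - 1) \<le> (1 - cmod (a n)) * 2" for n
    using norm_blaschke_factor_minus_1_le[of "a n" 0] an by simp
  then have "summable (\<lambda>n. cmod (blaschke_factor (a n) 0 - 1))"
    by (intro summable_comparison_test'[OF sum, of 0]) auto
  then have "convergent_prod (\<lambda>n. blaschke_factor (a n) 0)"
    by (intro abs_convergent_prod_imp_convergent_prod) (simp add: abs_convergent_prod_conv_summable)
  moreover have "blaschke_factor (a n) 0 \<noteq> 0" for n
    using an by (simp add: blaschke_factor_def)
  ultimately show ?thesis
    unfolding blaschke_prod_def by (rule prodinf_nonzero)
qed

text \<open>
  A constant product would have to take the value 0 at the origin, as it does at \<open>a 0\<close>.
\<close>
lemma deriv_blaschke_prod_not_identically_0:
  assumes a: "blaschke_seq a"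
  obtains z where "cmod z < 1" "deriv (blaschke_prod a) z \<noteq> 0"
proof -
  have "\<exists>z\<in>ball 0 1. deriv (blaschke_prod a) z \<noteq> 0"
  proof (rule ccontr)
    assume "\<not> ?thesis"
    then have "(blaschke_prod a has_field_derivative 0) (at z)" if "z \<in> ball 0 1" for z
      using holomorphic_derivI[OF holomorphic_blaschke_prod[OF a] open_ball that] that by force
    then obtain c where c: "\<And>z. z \<in> ball 0 1 \<Longrightarrow> blaschke_prod a z = c"
      using has_field_derivative_0_imp_constant_on[of "ball 0 1" "blaschke_prod a"]
      unfolding constant_on_def by force
    have "a 0 \<in> ball 0 1" using a by (simp add: blaschke_seq_def)
    with c[of "a 0"] c[of 0] show False
      using blaschke_prod_at_zero[OF a, of 0] blaschke_prod_0_nonzero[OF a] by simp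
  qed
  then show ?thesis using that by auto
qed

text \<open>
  In each term of the product rule the factors that are not differentiated have modulus at most 1.
\<close>
lemma norm_deriv_prod_le:
  fixes f :: "'i \<Rightarrow> complex \<Rightarrow> complex"
  assumes f: "\<And>i. i \<in> S \<Longrightarrow> f i field_differentiable at z"
    and le: "\<And>i. i \<in> S \<Longrightarrow> cmod (f i z) \<le> 1"
  shows "cmod (deriv (\<lambda>w. \<Prod>i\<in>S. f i w) z) \<le> (\<Sum>i\<in>S. cmod (deriv (f i) z))"
proof -
  have "((\<lambda>w. \<Prod>i\<in>S. f i w) has_field_derivative (\<Sum>i\<in>S. deriv (f i) z * (\<Prod>j\<in>S - {i}. f j z))) (at z)"
    by (intro has_field_derivative_prod field_differentiable_derivI f)
  then have "cmod (deriv (\<lambda>w. \<Prod>i\<in>S. f i w) z) \<le> (\<Sum>i\<in>S. cmod (deriv (f i) z * (\<Prod>j\<in>S - {i}. f j z)))"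
    by (simp add: DERIV_imp_deriv norm_sum)
  also have "\<dots> \<le> (\<Sum>i\<in>S. cmod (deriv (f i) z))"
  proof (rule sum_mono)
    fix i assume "i \<in> S"
    have "cmod (\<Prod>j\<in>S - {i}. f j z) \<le> 1"
      unfolding prod_norm[symmetric] using le by (intro prod_le_1) auto
    then show "cmod (deriv (f i) z * (\<Prod>j\<in>S - {i}. f j z)) \<le> cmod (deriv (f i) z)"
      by (simp add: norm_mult mult_left_le)
  qed
  finally show ?thesis .
qed

lemma norm_deriv_blaschke_prod_le:
  assumes a: "blaschke_seq a" and z: "cmod z < 1" and d: "d > 0"
    and lower: "\<And>n. d \<le> cmod (1 - cnj (a n) * z)"
  shows "cmod (deriv (blaschke_prod a) z) \<le> 2 * (\<Sum>n. 1 - cmod (a n)) / d\<^sup>2"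
proof -
  have an: "cmod (a n) < 1" for n
    using a by (auto simp: blaschke_seq_def)
  have sum: "summable (\<lambda>n. 1 - cmod (a n))" using a by (simp add: blaschke_seq_def)
  define r where "r = (1 + cmod z) / 2"
  have r: "r < 1" "cmod z < r" using z by (auto simp: r_def)
  have sub: "ball (0::complex) r \<subseteq> ball 0 1" using r by auto
  have lim: "(\<lambda>N. deriv (\<lambda>z. \<Prod>n<N. blaschke_factor (a n) z) z) \<longlonglongrightarrow> deriv (blaschke_prod a) z"
  proof (rule deriv_complex_uniform_limit)
    show "uniform_limit (ball 0 r) (\<lambda>N z. \<Prod>n<N. blaschke_factor (a n) z) (blaschke_prod a) sequentially"
      by (rule uniform_limit_on_subset[OF uniform_limit_blaschke_prod[OF a r(1)]]) auto
    show "\<forall>\<^sub>F N in sequentially. (\<lambda>z. \<Prod>n<N. blaschke_factor (a n) z) holomorphic_on ball 0 r"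
      by (rule always_eventually)
        (use holomorphic_on_subset[OF holomorphic_prod_blaschke_factor[OF a] sub] in auto)
  qed (use r in auto)
  have bound: "cmod (deriv (\<lambda>z. \<Prod>n<N. blaschke_factor (a n) z) z) \<le> 2 * (\<Sum>n. 1 - cmod (a n)) / d\<^sup>2" for N
  proof -
    have "cmod (deriv (\<lambda>z. \<Prod>n<N. blaschke_factor (a n) z) z) \<le> (\<Sum>n<N. cmod (deriv (blaschke_factor (a n)) z))"
      using z by (intro norm_deriv_prod_le norm_blaschke_factor_le_1 an
          holomorphic_on_imp_differentiable_at[OF holomorphic_blaschke_factor[OF an]]) auto
    also have "\<dots> \<le> (\<Sum>n<N. 2 * (1 - cmod (a n)) / d\<^sup>2)"
    proof (rule sum_mono)
      fix n
      have "cmod (deriv (blaschke_factor (a n)) z) \<le> 2 * (1 - cmod (a n)) / (cmod (1 - cnj (a n) * z))\<^sup>2"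
        using an z by (rule norm_deriv_blaschke_factor_le)
      also have "\<dots> \<le> 2 * (1 - cmod (a n)) / d\<^sup>2"
        using an[of n] lower[of n] d by (intro divide_left_mono power_mono mult_pos_pos) auto
      finally show "cmod (deriv (blaschke_factor (a n)) z) \<le> 2 * (1 - cmod (a n)) / d\<^sup>2" .
    qed
    also have "\<dots> = 2 * (\<Sum>n<N. 1 - cmod (a n)) / d\<^sup>2"
      by (simp add: sum_divide_distrib sum_distrib_left)
    also have "\<dots> \<le> 2 * (\<Sum>n. 1 - cmod (a n)) / d\<^sup>2"
      using sum_le_suminf[OF sum, of "{..<N}"] an
      by (intro divide_right_mono mult_left_mono) (auto simp: less_imp_le)
    finally show ?thesis .
  qed
  show ?thesis
    by (rule LIMSEQ_le_const2[OF tendsto_norm[OF lim]]) (use bound in auto)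
qed

text \<open>
  Compares a linear lower bound with the gauge: up to the factor \<open>1 / \<rho>\<close> in the exponent, \<open>exp_gauge\<close>
  is dominated by the identity.
\<close>
lemma exp_neg_powr_le_self:
  assumes "0 < (y::real)" "y \<le> 1" "\<rho> > 0"
  shows "exp (- (y powr (- \<rho>) / \<rho>)) \<le> y"
proof -
  have "ln (1 / y) \<le> (1 / y) powr \<rho> / \<rho>"
    using assms by (intro ln_powr_bound) auto
  then have "- (y powr (- \<rho>) / \<rho>) \<le> ln y"
    using assms by (simp add: ln_div powr_minus_divide powr_divide)
  then show ?thesis using assms by (metis exp_le_cancel_iff exp_ln)
qed

text \<open>
  With \<open>y = \<bar>t - z\<bar> / 2\<close>, either \<open>\<bar>t - w\<bar> \<ge> y\<close>, so that the Stolz condition bounds \<open>1 - \<bar>w\<bar>\<close>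
  from below by the gauge at \<open>y\<close>, or \<open>\<bar>w - z\<bar> \<ge> y\<close>. The constant in the exponent is chosen to be the
  sum of the exponents that the two cases need.
\<close>
lemma stolz_angle_separation:
  assumes t: "cmod t = 1" and \<rho>: "\<rho> > 0" and K: "K > 0"
    and w: "w \<in> stolz_angle (exp_gauge \<rho>) t K" and z: "cmod z < 1"
  shows "min 1 (1 / K) * exp (- ((1 + 1 / \<rho>) * 2 powr \<rho> * cmod (t - z) powr (- \<rho>))) \<le> cmod (1 - cnj w * z)"
proof -
  define y where "y = cmod (t - z) / 2"
  have "t \<noteq> z" using t z by auto
  then have y: "y > 0" by (simp add: y_def)
  have y1: "y \<le> 1" unfolding y_def using norm_triangle_ineq4[of t z] t z by simp
  have ypow: "y powr (- \<rho>) = 2 powr \<rho> * cmod (t - z) powr (- \<rho>)"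
    unfolding y_def by (simp add: powr_divide powr_minus_divide)
  have w1: "cmod w < 1" and stolz: "exp_gauge \<rho> (cmod (t - w)) \<le> K * (1 - cmod w)"
    using w by (auto simp: stolz_angle_def)
  have expand: "(1 + 1 / \<rho>) * 2 powr \<rho> * cmod (t - z) powr (- \<rho>) = y powr (- \<rho>) + y powr (- \<rho>) / \<rho>"
    unfolding ypow using \<rho> by (simp add: field_simps)
  let ?e = "exp (- (y powr (- \<rho>) + y powr (- \<rho>) / \<rho>))"
  have e1: "?e \<le> exp (- (y powr (- \<rho>)))" and e2: "?e \<le> exp (- (y powr (- \<rho>) / \<rho>))"
    using \<rho> by auto
  have "min 1 (1 / K) * ?e \<le> cmod (1 - cnj w * z)"
  proof (cases "y \<le> cmod (t - w)")
    case True
    have "cmod (t - w) powr (- \<rho>) \<le> y powr (- \<rho>)"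
      using True y \<rho> by (intro powr_mono2') auto
    then have "exp (- (y powr (- \<rho>))) \<le> exp_gauge \<rho> (cmod (t - w))"
      using True y by (auto simp: exp_gauge_def)
    with stolz e1 have "?e \<le> K * (1 - cmod w)" by linarith
    then have "1 / K * ?e \<le> 1 - cmod w" using K by (simp add: field_simps)
    moreover have "min 1 (1 / K) * ?e \<le> 1 / K * ?e" by (intro mult_right_mono) auto
    moreover have "1 - cmod w \<le> cmod (1 - cnj w * z)"
      using z by (intro norm_one_minus_cnj_mult_ge) simp
    ultimately show ?thesis by linarith
  next
    case False
    have "cmod (t - z) \<le> cmod (t - w) + cmod (w - z)"
      using norm_triangle_ineq[of "t - w" "w - z"] by simp
    with False have "y \<le> cmod (w - z)" by (simp add: y_def)
    also have "\<dots> \<le> cmod (1 - cnj w * z)"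
      using w1 z by (intro norm_diff_le_norm_one_minus_cnj_mult) auto
    finally have "y \<le> cmod (1 - cnj w * z)" .
    moreover have "?e \<le> y" using e2 exp_neg_powr_le_self[OF y y1 \<rho>] by linarith
    moreover have "min 1 (1 / K) * ?e \<le> 1 * ?e" by (intro mult_right_mono) auto
    ultimately show ?thesis by linarith
  qed
  then show ?thesis unfolding expand .
qed

lemma deriv_blaschke_prod_growth:
  assumes t: "cmod t = 1" and \<rho>: "\<rho> > 0" and K: "K > 0"
    and a: "blaschke_seq a" and stolz: "range a \<subseteq> stolz_angle (exp_gauge \<rho>) t K"
  shows "\<exists>A\<ge>0. \<forall>z\<in>ball 0 1. cmod (deriv (blaschke_prod a) z) \<le> exp (A * cmod (t - z) powr (- \<rho>))"
proof -
  define c where "c = min 1 (1 / K)"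
  define L where "L = (1 + 1 / \<rho>) * 2 powr \<rho>"
  define D where "D = 2 * (\<Sum>n. 1 - cmod (a n)) / c\<^sup>2"
  have c: "c > 0" using K by (simp add: c_def)
  have "0 \<le> (\<Sum>n. 1 - cmod (a n))"
    using a by (intro suminf_nonneg) (auto simp: blaschke_seq_def less_imp_le)
  then have D: "D \<ge> 0" by (simp add: D_def)
  have L: "L \<ge> 0" using \<rho> by (simp add: L_def)
  have "cmod (deriv (blaschke_prod a) z) \<le> exp ((D * 2 powr \<rho> + 2 * L) * cmod (t - z) powr (- \<rho>))"
    if z: "cmod z < 1" for z
  proof -
    let ?x = "cmod (t - z) powr (- \<rho>)"
    have tz: "t \<noteq> z" using t z by auto
    have "cmod (t - z) \<le> 2" using norm_triangle_ineq4[of t z] t z by simp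
    then have "2 powr (- \<rho>) \<le> ?x" using \<rho> tz by (intro powr_mono2') auto
    then have "2 powr \<rho> * 2 powr (- \<rho>) \<le> 2 powr \<rho> * ?x" by (intro mult_left_mono) auto
    then have x: "1 \<le> 2 powr \<rho> * ?x" by (simp flip: powr_add)
    have "cmod (deriv (blaschke_prod a) z) \<le> 2 * (\<Sum>n. 1 - cmod (a n)) / (c * exp (- (L * ?x)))\<^sup>2"
    proof (rule norm_deriv_blaschke_prod_le[OF a z])
      show "c * exp (- (L * ?x)) \<le> cmod (1 - cnj (a n) * z)" for n
        unfolding c_def L_def using stolz by (intro stolz_angle_separation t \<rho> K z) auto
    qed (use c in auto)
    also have "\<dots> = D * exp (2 * L * ?x)"
      by (simp add: D_def power_mult_distrib exp_minus exp_double[symmetric] divide_inverse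
          power_inverse[symmetric] mult_ac)
    \<comment> \<open>\<open>\<bar>t - z\<bar> \<le> 2\<close> lets the constant \<open>D\<close> be absorbed into the exponent.\<close>
    also have "\<dots> \<le> exp D * exp (2 * L * ?x)"
      using exp_ge_add_one_self[of D] by (intro mult_right_mono) (linarith, simp)
    also have "\<dots> \<le> exp (D * (2 powr \<rho> * ?x)) * exp (2 * L * ?x)"
      using mult_left_mono[OF x D] by (intro mult_right_mono) auto
    also have "\<dots> = exp ((D * 2 powr \<rho> + 2 * L) * ?x)"
      by (simp add: exp_add[symmetric] algebra_simps)
    finally show ?thesis .
  qed
  then show ?thesis using D L by (intro exI[of _ "D * 2 powr \<rho> + 2 * L"]) auto
qed

section \<open>Zeros of functions of finite order in the right half-plane\<close>

text \<open>
  The Blaschke factor of the half-disc \<open>Re v > 0\<close>, \<open>\<bar>v\<bar> < R\<close> with zero \<open>p\<close>. Reflecting \<open>p\<close> in the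
  imaginary axis and in the circle gives the points \<open>- cnj p\<close>, \<open>R\<^sup>2 / cnj p\<close> and, applying both,
  \<open>- R\<^sup>2 / p\<close>; they enter as poles and zeros in the way that makes the modulus 1 on both parts of the
  boundary.
\<close>
definition half_disc_factor :: "real \<Rightarrow> complex \<Rightarrow> complex \<Rightarrow> complex" where
  "half_disc_factor R p v =
     (v - p) * (of_real (R\<^sup>2) + p * v) / ((v + cnj p) * (of_real (R\<^sup>2) - cnj p * v))"

lemma norm_add_cnj_sq: "(cmod (v + cnj p))\<^sup>2 = (cmod (v - p))\<^sup>2 + 4 * Re v * Re p"
  unfolding cmod_power2 by (simp add: power2_eq_square algebra_simps)

lemma norm_of_real_add_mult_sq:
  "(cmod (of_real c + p * v))\<^sup>2 = (cmod (of_real c - cnj p * v))\<^sup>2 + 4 * c * Re v * Re p"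
  unfolding cmod_power2 by (simp add: power2_eq_square algebra_simps)

lemma add_cnj_nonzero: "v + cnj p \<noteq> 0" if "Re v > 0" "Re p > 0"
proof
  assume "v + cnj p = 0"
  then have "Re (v + cnj p) = 0" by simp
  with that show False by simp
qed

lemma norm_of_real_minus_cnj_mult_ge:
  assumes "cmod p \<le> a" "cmod v \<le> b" "a \<ge> 0"
  shows "c - a * b \<le> cmod (of_real c - cnj p * v)" "c - a * b \<le> cmod (of_real c + p * v)"
proof -
  have ab: "cmod p * cmod v \<le> a * b"
    using assms by (intro mult_mono) auto
  have "cmod (complex_of_real c) - cmod (cnj p * v) \<le> cmod (of_real c - cnj p * v)"
    by (rule norm_triangle_ineq2)
  then show "c - a * b \<le> cmod (of_real c - cnj p * v)"
    using ab by (simp add: norm_mult)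
  have "cmod (complex_of_real c) - cmod (p * v) \<le> cmod (of_real c + p * v)"
    by (rule norm_diff_ineq)
  then show "c - a * b \<le> cmod (of_real c + p * v)"
    using ab by (simp add: norm_mult)
qed

lemma of_real_sq_plus_minus_mult_nonzero:
  assumes "cmod p < R" "cmod v \<le> R"
  shows "of_real (R\<^sup>2) - cnj p * v \<noteq> 0" "of_real (R\<^sup>2) + p * v \<noteq> 0"
proof -
  have "R > 0" using assms(1) norm_ge_zero[of p] by linarith
  then have "R\<^sup>2 - cmod p * R > 0" using assms by (simp add: power2_eq_square)
  then show "of_real (R\<^sup>2) - cnj p * v \<noteq> 0" "of_real (R\<^sup>2) + p * v \<noteq> 0"
    using norm_of_real_minus_cnj_mult_ge[of p "cmod p" v R "R\<^sup>2"] assms by auto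
qed

text \<open>
  The quotient here is \<open>(v - p) / half_disc_factor R p v\<close>, written so that it makes sense at \<open>v = p\<close>
  too. It replaces the factor \<open>v - p\<close> when the zeros are divided out.
\<close>
lemma norm_half_disc_denominator_on_arc:
  assumes "cmod v = R" "cmod p < R"
  shows "cmod ((v + cnj p) * (of_real (R\<^sup>2) - cnj p * v) / (of_real (R\<^sup>2) + p * v)) = cmod (v - p)"
proof -
  have R: "R > 0" using assms norm_ge_zero[of p] by linarith
  have sq: "of_real (R\<^sup>2) = v * cnj v" using assms(1) complex_norm_square[of v] by simp
  have "of_real (R\<^sup>2) - cnj p * v = v * cnj (v - p)" "of_real (R\<^sup>2) + p * v = v * cnj (v + cnj p)"
    unfolding sq by (simp_all add: algebra_simps)
  then have "cmod (of_real (R\<^sup>2) - cnj p * v) = R * cmod (v - p)"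
      "cmod (of_real (R\<^sup>2) + p * v) = R * cmod (v + cnj p)"
    using assms(1) by (simp_all only: norm_mult complex_mod_cnj)
  moreover have "v + cnj p \<noteq> 0"
    using assms by (metis add_eq_0_iff complex_mod_cnj less_irrefl norm_minus_cancel)
  ultimately show ?thesis using R by (simp add: norm_mult norm_divide)
qed

text \<open>
  The growth hypothesis is only available inside the half-plane, so the maximum principle is used on
  \<open>Re v \<ge> \<eta>\<close>. There the half-disc factor has modulus slightly less than 1 on the straight edge;
  the loss is controlled by the part \<open>(v - p) / (v + cnj p)\<close>, whose squared modulus is
  \<open>1 - 4 * Re v * Re p / \<bar>v + cnj p\<bar>\<^sup>2\<close>.
\<close>
lemma norm_half_disc_denominator_near_axis:
  assumes "Re v > 0" "Re p > 0" "cmod v \<le> R" "cmod p < R"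
  shows "(cmod ((v + cnj p) * (of_real (R\<^sup>2) - cnj p * v) / (of_real (R\<^sup>2) + p * v)))\<^sup>2
           * (1 - 4 * Re v / Re p) \<le> (cmod (v - p))\<^sup>2"
proof -
  let ?n = "of_real (R\<^sup>2) - cnj p * v" and ?d = "of_real (R\<^sup>2) + p * v"
  have nz: "?d \<noteq> 0" using of_real_sq_plus_minus_mult_nonzero assms by blast
  have "(cmod ?n)\<^sup>2 \<le> (cmod ?d)\<^sup>2"
    unfolding norm_of_real_add_mult_sq using assms by simp
  then have "cmod ?n \<le> cmod ?d" by (rule power2_le_imp_le) simp
  then have "cmod ((v + cnj p) * ?n / ?d) \<le> cmod (v + cnj p)"
    using nz by (simp add: norm_mult norm_divide divide_le_eq mult_left_mono)
  then have le: "(cmod ((v + cnj p) * ?n / ?d))\<^sup>2 \<le> (cmod (v + cnj p))\<^sup>2"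
    by (intro power_mono) auto
  show ?thesis
  proof (cases "1 - 4 * Re v / Re p \<ge> 0")
    case True
    have "(Re p)\<^sup>2 \<le> (cmod (v + cnj p))\<^sup>2"
      using abs_Re_le_cmod[of "v + cnj p"] assms by (intro power_mono) auto
    then have "Re p * Re p * (4 * Re v / Re p) \<le> (cmod (v + cnj p))\<^sup>2 * (4 * Re v / Re p)"
      using assms by (intro mult_right_mono) (auto simp: power2_eq_square)
    then have "4 * Re v * Re p \<le> (cmod (v + cnj p))\<^sup>2 * (4 * Re v / Re p)"
      using assms by (simp add: mult_ac)
    then have "(cmod (v + cnj p))\<^sup>2 * (1 - 4 * Re v / Re p) \<le> (cmod (v - p))\<^sup>2"
      using norm_add_cnj_sq[of v p] by (simp add: right_diff_distrib)
    with mult_right_mono[OF le True] show ?thesis by linarith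
  next
    case False
    then have "(cmod ((v + cnj p) * ?n / ?d))\<^sup>2 * (1 - 4 * Re v / Re p) \<le> 0"
      by (intro mult_nonneg_nonpos) auto
    then show ?thesis by (smt (verit) zero_le_power2)
  qed
qed

text \<open>
  Dividing the function by its half-disc Blaschke product gives \<open>G\<close>, which is holomorphic on the
  half-disc. On the boundary of the truncated half-disc \<open>Re v \<ge> \<eta>\<close>, its modulus is at most
  \<open>1 / sqrt (E \<eta>)\<close>, and \<open>E \<eta>\<close> tends to 1 as \<open>\<eta>\<close> tends to 0.
\<close>
lemma half_disc_max_principle:
  fixes m :: "complex \<Rightarrow> nat"
  assumes fin: "finite S" and S: "\<And>p. p \<in> S \<Longrightarrow> Re p > 0 \<and> cmod p < R"
    and hol: "h holomorphic_on {v. Re v > 0}"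
    and bound: "\<And>v. Re v > 0 \<Longrightarrow> cmod v \<le> R \<Longrightarrow> cmod (h v * (\<Prod>p\<in>S. (v - p) ^ m p)) \<le> 1"
    and v0: "Re v0 > 0" "cmod v0 < R"
  shows "cmod (h v0 * (\<Prod>p\<in>S. (v0 - p) ^ m p)) \<le> (\<Prod>p\<in>S. cmod (half_disc_factor R p v0) ^ m p)"
proof -
  define D where "D = (\<lambda>p v. (v + cnj p) * (of_real (R\<^sup>2) - cnj p * v) / (of_real (R\<^sup>2) + p * v))"
  define G where "G = (\<lambda>v. h v * (\<Prod>p\<in>S. D p v ^ m p))"
  define E where "E = (\<lambda>\<eta>. \<Prod>p\<in>S. (1 - 4 * \<eta> / Re p) ^ m p)"
  have hol_G: "G holomorphic_on {v. Re v > 0 \<and> cmod v \<le> R}"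
    unfolding G_def D_def
    by (intro holomorphic_intros holomorphic_on_subset[OF hol])
      (use of_real_sq_plus_minus_mult_nonzero S in auto)
  have small: "(cmod (G v0))\<^sup>2 * E \<eta> \<le> 1"
    if \<eta>: "\<eta> > 0" "\<eta> < Re v0" "\<And>p. p \<in> S \<Longrightarrow> 4 * \<eta> < Re p" for \<eta>
  proof -
    define T where "T = {v. \<eta> \<le> Re v} \<inter> cball 0 R"
    have pos: "1 - 4 * \<eta> / Re p > 0" if "p \<in> S" for p
      using \<eta>(3)[OF that] S[OF that] by (simp add: divide_simps)
    then have E: "E \<eta> > 0" unfolding E_def by (intro prod_pos) auto
    have clT: "closed T" unfolding T_def by (intro closed_Int closed_halfspace_Re_ge) auto
    have subT: "T \<subseteq> {v. Re v > 0 \<and> cmod v \<le> R}" using \<eta> by (auto simp: T_def)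
    have front: "cmod (G v) \<le> 1 / sqrt (E \<eta>)" if v: "v \<in> frontier T" for v
    proof -
      have vT: "v \<in> T" using v clT frontier_subset_closed by blast
      have edge: "Re v = \<eta> \<or> cmod v = R"
      proof (rule ccontr)
        assume "\<not> ?thesis"
        with vT have "v \<in> {v. \<eta> < Re v} \<inter> ball 0 R" by (auto simp: T_def)
        moreover have "open ({v. \<eta> < Re v} \<inter> ball 0 R)"
          by (intro open_Int open_halfspace_Re_gt) auto
        moreover have "{v. \<eta> < Re v} \<inter> ball 0 R \<subseteq> T" by (auto simp: T_def)
        ultimately have "v \<in> interior T" by (meson interiorI)
        with v show False by (simp add: frontier_def)
      qed
      have "(cmod (D p v))\<^sup>2 * (1 - 4 * \<eta> / Re p) \<le> (cmod (v - p))\<^sup>2" if p: "p \<in> S" for p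
        using edge
      proof
        assume "Re v = \<eta>"
        then show ?thesis
          using norm_half_disc_denominator_near_axis[of v p R] vT S[OF p] \<eta>(1)
          by (auto simp: D_def T_def)
      next
        assume "cmod v = R"
        then have "cmod (D p v) = cmod (v - p)"
          using norm_half_disc_denominator_on_arc S[OF p] by (simp add: D_def)
        then show ?thesis using pos[OF p] S[OF p] \<eta>(1) by (simp add: mult_left_le)
      qed
      then have "(\<Prod>p\<in>S. ((cmod (D p v))\<^sup>2 * (1 - 4 * \<eta> / Re p)) ^ m p) \<le> (\<Prod>p\<in>S. ((cmod (v - p))\<^sup>2) ^ m p)"
        using pos by (intro prod_mono conjI power_mono zero_le_power mult_nonneg_nonneg) (auto simp: less_imp_le)
      then have "(cmod (h v))\<^sup>2 * (\<Prod>p\<in>S. ((cmod (D p v))\<^sup>2 * (1 - 4 * \<eta> / Re p)) ^ m p)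
          \<le> (cmod (h v))\<^sup>2 * (\<Prod>p\<in>S. ((cmod (v - p))\<^sup>2) ^ m p)"
        by (rule mult_left_mono) simp
      also have "\<dots> = (cmod (h v * (\<Prod>p\<in>S. (v - p) ^ m p)))\<^sup>2"
        by (simp add: norm_mult power_mult_distrib prod_norm[symmetric] norm_power prod_power_distrib
            power_mult[symmetric] mult.commute)
      also have "\<dots> \<le> 1"
        using bound[of v] vT subT by (auto simp: power_le_one)
      also have "(cmod (h v))\<^sup>2 * (\<Prod>p\<in>S. ((cmod (D p v))\<^sup>2 * (1 - 4 * \<eta> / Re p)) ^ m p)
          = (cmod (G v))\<^sup>2 * E \<eta>"
        by (simp add: G_def E_def norm_mult power_mult_distrib prod_norm[symmetric] norm_power
            prod_power_distrib prod.distrib power_mult[symmetric] mult.commute[of _ 2])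
      finally have "(cmod (G v) * sqrt (E \<eta>))\<^sup>2 \<le> 1\<^sup>2"
        using E by (simp add: power_mult_distrib)
      then have "cmod (G v) * sqrt (E \<eta>) \<le> 1" by (rule power2_le_imp_le) simp
      then show ?thesis using E by (simp add: divide_simps)
    qed
    have "cmod (G v0) \<le> 1 / sqrt (E \<eta>)"
    proof (rule maximum_modulus_frontier[of G T])
      show "G holomorphic_on interior T"
        using hol_G subT interior_subset by (meson holomorphic_on_subset)
      show "continuous_on (closure T) G"
        using hol_G subT clT by (metis closure_closed continuous_on_subset holomorphic_on_imp_continuous_on)
      show "bounded T" by (auto simp: T_def intro: bounded_Int)
      show "v0 \<in> T" using v0 \<eta> by (simp add: T_def)
    qed (use front in auto)
    then have "cmod (G v0) * sqrt (E \<eta>) \<le> 1" using E by (simp add: divide_simps)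
    then have "(cmod (G v0) * sqrt (E \<eta>))\<^sup>2 \<le> 1" using E by (intro power_le_one) auto
    then show ?thesis using E by (simp add: power_mult_distrib)
  qed
  have "((\<lambda>\<eta>. (cmod (G v0))\<^sup>2 * E \<eta>) \<longlongrightarrow> (cmod (G v0))\<^sup>2 * E 0) (at_right 0)"
    unfolding E_def by (intro tendsto_intros) (use S in force)
  moreover have "eventually (\<lambda>\<eta>. (cmod (G v0))\<^sup>2 * E \<eta> \<le> 1) (at_right 0)"
  proof -
    have "eventually (\<lambda>\<eta>. \<forall>p\<in>S. 4 * \<eta> < Re p) (at_right 0)"
    proof (subst eventually_ball_finite_distrib[OF fin], safe)
      fix p assume "p \<in> S"
      then have "eventually (\<lambda>\<eta>. \<eta> < Re p / 4) (at_right 0)"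
        using S by (intro eventually_at_right_less order_tendstoD(2)[OF tendsto_ident_at]) auto
      then show "eventually (\<lambda>\<eta>. 4 * \<eta> < Re p) (at_right 0)"
        by eventually_elim auto
    qed
    moreover have "eventually (\<lambda>\<eta>. \<eta> < Re v0) (at_right 0)"
      using v0 by (intro order_tendstoD(2)[OF tendsto_ident_at]) auto
    moreover have "eventually (\<lambda>\<eta>. \<eta> > (0::real)) (at_right 0)"
      by (rule eventually_at_right_less)
    ultimately show ?thesis by eventually_elim (use small in auto)
  qed
  ultimately have "(cmod (G v0))\<^sup>2 * E 0 \<le> 1"
    by (rule tendsto_upperbound) simp
  then have "(cmod (G v0))\<^sup>2 \<le> 1\<^sup>2" by (simp add: E_def)
  then have G1: "cmod (G v0) \<le> 1" by (rule power2_le_imp_le) simp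
  have "v0 - p = D p v0 * half_disc_factor R p v0" if p: "p \<in> S" for p
    using of_real_sq_plus_minus_mult_nonzero[of p R v0] add_cnj_nonzero[of v0 p] S[OF p] v0
    by (simp add: D_def half_disc_factor_def)
  then have "h v0 * (\<Prod>p\<in>S. (v0 - p) ^ m p) = h v0 * (\<Prod>p\<in>S. (D p v0 * half_disc_factor R p v0) ^ m p)"
    by (metis (no_types, lifting) prod.cong)
  also have "\<dots> = G v0 * (\<Prod>p\<in>S. half_disc_factor R p v0 ^ m p)"
    by (simp add: G_def power_mult_distrib prod.distrib)
  finally have "cmod (h v0 * (\<Prod>p\<in>S. (v0 - p) ^ m p)) = cmod (G v0) * (\<Prod>p\<in>S. cmod (half_disc_factor R p v0) ^ m p)"
    by (simp add: norm_mult prod_norm[symmetric] norm_power)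
  also have "\<dots> \<le> 1 * (\<Prod>p\<in>S. cmod (half_disc_factor R p v0) ^ m p)"
    using G1 by (intro mult_right_mono prod_nonneg) auto
  finally show ?thesis by simp
qed

text \<open>
  The radius \<open>4 * R\<close> keeps \<open>v\<close> and \<open>p\<close> away from the arc. The reflections in the circle, which push the
  modulus up, then cost at most half of what the reflection in the axis gains.
\<close>
lemma half_disc_factor_upper_bound:
  assumes v: "Re v > 0" "cmod v \<le> R" and p: "Re p > 0" "cmod p \<le> R"
  shows "(cmod (half_disc_factor (4 * R) p v))\<^sup>2 \<le> 1 - 2 * Re v * Re p / (cmod (v + cnj p))\<^sup>2"
proof -
  define u where "u = (cmod (v + cnj p))\<^sup>2"
  define q where "q = (cmod (of_real ((4 * R)\<^sup>2) - cnj p * v))\<^sup>2"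
  define x where "x = Re v * Re p"
  have R: "R > 0" using v complex_Re_le_cmod[of v] by linarith
  have x: "x > 0" using v p by (simp add: x_def)
  have u: "u > 0" using add_cnj_nonzero v p by (simp add: u_def)
  have ux: "(cmod (v - p))\<^sup>2 = u - 4 * x"
    using norm_add_cnj_sq[of v p] by (simp add: u_def x_def)
  have qx: "(cmod (of_real ((4 * R)\<^sup>2) + p * v))\<^sup>2 = q + 64 * R\<^sup>2 * x"
    using norm_of_real_add_mult_sq[of "(4 * R)\<^sup>2" p v] by (simp add: q_def x_def power_mult_distrib)
  have "(4 * R)\<^sup>2 - R * R \<le> cmod (of_real ((4 * R)\<^sup>2) - cnj p * v)"
    using v p R by (intro norm_of_real_minus_cnj_mult_ge) auto
  then have "15 * R\<^sup>2 \<le> cmod (of_real ((4 * R)\<^sup>2) - cnj p * v)"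
    by (simp add: power2_eq_square)
  then have "(15 * R\<^sup>2)\<^sup>2 \<le> q" unfolding q_def by (intro power_mono) auto
  moreover have "u \<le> (2 * R)\<^sup>2"
    unfolding u_def using norm_triangle_ineq[of v "cnj p"] v p by (intro power_mono) auto
  then have "32 * R\<^sup>2 * u \<le> 32 * R\<^sup>2 * (2 * R)\<^sup>2" by (intro mult_left_mono) auto
  moreover have "32 * R\<^sup>2 * (2 * R)\<^sup>2 = 128 * (R\<^sup>2)\<^sup>2" "(15 * R\<^sup>2)\<^sup>2 = 225 * (R\<^sup>2)\<^sup>2"
    by (simp_all add: power2_eq_square)
  moreover have "(R\<^sup>2)\<^sup>2 > 0" using R by simp
  ultimately have q: "32 * R\<^sup>2 * u \<le> q" "q > 0" by linarith+
  have "(32 * R\<^sup>2 * u) * (2 * x) \<le> q * (2 * x)" using q x by (intro mult_right_mono) auto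
  moreover have "0 \<le> 256 * R\<^sup>2 * x * x" using x by simp
  ultimately have "(u - 4 * x) * (q + 64 * R\<^sup>2 * x) \<le> (u - 2 * x) * q"
    by (simp add: algebra_simps)
  then have "(u - 4 * x) * (q + 64 * R\<^sup>2 * x) / (u * q) \<le> (u - 2 * x) * q / (u * q)"
    using u q by (intro divide_right_mono) auto
  moreover have "(cmod (half_disc_factor (4 * R) p v))\<^sup>2 = (u - 4 * x) * (q + 64 * R\<^sup>2 * x) / (u * q)"
    unfolding half_disc_factor_def norm_divide norm_mult power_divide power_mult_distrib[of "cmod _"]
    by (simp only: ux qx u_def[symmetric] q_def[symmetric])
  moreover have "(u - 2 * x) * q / (u * q) = 1 - 2 * Re v * Re p / u"
    using u q by (simp add: x_def field_simps)
  ultimately show ?thesis by (simp add: u_def)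
qed

text \<open>
  This is where \<open>\<sigma> < 1\<close> matters: the argument of \<open>w powr \<sigma>\<close> is at most \<open>pi * \<sigma> / 2 < pi / 2\<close> in modulus.
\<close>
lemma Re_powr_ge:
  assumes "Re w > 0" "0 < \<sigma>" "\<sigma> < 1"
  shows "cos (pi * \<sigma> / 2) * cmod w powr \<sigma> \<le> Re (w powr of_real \<sigma>)"
proof -
  have w: "w \<noteq> 0" using assms by auto
  have Arg: "\<bar>Im (Ln w)\<bar> < pi / 2" using assms Re_Ln_pos_lt[OF w] by simp
  have "w powr of_real \<sigma> = exp (of_real \<sigma> * Ln w)" using w by (simp add: powr_def)
  then have "Re (w powr of_real \<sigma>) = exp (\<sigma> * Re (Ln w)) * cos (\<sigma> * Im (Ln w))"
    by (simp add: Re_exp)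
  also have "exp (\<sigma> * Re (Ln w)) = cmod w powr \<sigma>" using w by (simp add: powr_def)
  finally have eq: "Re (w powr of_real \<sigma>) = cmod w powr \<sigma> * cos (\<sigma> * Im (Ln w))" .
  have "\<sigma> * \<bar>Im (Ln w)\<bar> \<le> \<sigma> * (pi / 2)" using Arg assms by (intro mult_left_mono) auto
  moreover have "\<sigma> * (pi / 2) \<le> 1 * (pi / 2)" using assms by (intro mult_right_mono) auto
  ultimately have "cos (\<sigma> * (pi / 2)) \<le> cos (\<sigma> * \<bar>Im (Ln w)\<bar>)"
    using assms by (intro cos_monotone_0_pi_le) (use pi_gt_zero in auto)
  also have "cos (\<sigma> * \<bar>Im (Ln w)\<bar>) = cos (\<sigma> * Im (Ln w))"
    using assms by (cases "Im (Ln w) \<ge> 0") auto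
  finally have "cos (pi * \<sigma> / 2) \<le> cos (\<sigma> * Im (Ln w))" by (simp add: mult.commute)
  then show ?thesis unfolding eq by (simp add: mult.commute mult_left_mono)
qed

text \<open>
  A Jensen inequality for the half-plane. The zeros are given by an arbitrary factorization of \<open>g\<close>, and
  \<open>C\<close> depends on neither the factorization nor \<open>R\<close>. The weight \<open>Re p / \<bar>p + 1\<bar>\<^sup>2\<close> corresponds to
  \<open>(1 - \<bar>z\<bar>\<^sup>2) / 4\<close> in the disc (see \<open>cayley_disc_to_half_plane\<close>). The proof multiplies \<open>g\<close> by the
  function \<open>damp\<close>, which makes it bounded by 1 on the half-disc of radius \<open>4 * R\<close>, applies the maximum
  principle at \<open>v0\<close> and takes logarithms.
\<close>
lemma half_plane_zeros_sum_le:
  fixes g :: "complex \<Rightarrow> complex"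
  assumes \<sigma>: "0 < \<sigma>" "\<sigma> < 1" "\<sigma> \<le> \<rho>" and A: "A \<ge> 0"
    and v0: "Re v0 > 0" "g v0 \<noteq> 0"
    and growth: "\<forall>v. Re v > 0 \<longrightarrow> cmod (g v) \<le> exp (A * cmod (v + 1) powr \<rho>)"
  shows "\<exists>C\<ge>0. \<forall>R S h (m :: complex \<Rightarrow> nat). R \<ge> cmod v0 + 1 \<longrightarrow> finite S \<longrightarrow>
       (\<forall>p\<in>S. Re p > 0 \<and> cmod p \<le> R) \<longrightarrow> h holomorphic_on {v. Re v > 0} \<longrightarrow>
       (\<forall>v. Re v > 0 \<longrightarrow> g v = h v * (\<Prod>p\<in>S. (v - p) ^ m p)) \<longrightarrow>
       (\<Sum>p\<in>S. m p * (Re p / (cmod (p + 1))\<^sup>2)) \<le> C * R powr (\<rho> - \<sigma>)"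
proof -
  define \<beta> where "\<beta> = \<rho> - \<sigma>"
  define \<kappa> where "\<kappa> = cos (pi * \<sigma> / 2)"
  define k where "k = Re v0 / (cmod v0 + 1)\<^sup>2"
  define w where "w = cmod (v0 + 1) powr \<sigma>"
  define C where "C = (A * 5 powr \<beta> / \<kappa> * w + \<bar>ln (cmod (g v0))\<bar>) / k"
  have \<beta>: "\<beta> \<ge> 0" using \<sigma> by (simp add: \<beta>_def)
  have "pi * \<sigma> < pi * 1" using \<sigma> by (intro mult_strict_left_mono) auto
  then have \<kappa>: "\<kappa> > 0" unfolding \<kappa>_def using \<sigma> by (intro cos_gt_zero) auto
  have k: "k > 0" using v0 by (auto simp: k_def intro!: divide_pos_pos zero_less_power add_nonneg_pos)
  have w: "w \<ge> 0" by (simp add: w_def)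
  have C: "C \<ge> 0" using A \<kappa> k w by (simp add: C_def)
  have *: "(\<Sum>p\<in>S. m p * (Re p / (cmod (p + 1))\<^sup>2)) \<le> C * R powr \<beta>"
    if R: "R \<ge> cmod v0 + 1" and fin: "finite S" and S: "\<And>p. p \<in> S \<Longrightarrow> Re p > 0 \<and> cmod p \<le> R"
      and hol: "h holomorphic_on {v. Re v > 0}"
      and g: "\<And>v. Re v > 0 \<Longrightarrow> g v = h v * (\<Prod>p\<in>S. (v - p) ^ m p)"
    for R S h and m :: "complex \<Rightarrow> nat"
  proof -
    define N where "N = A * (5 * R) powr \<beta> / \<kappa>"
    define damp where "damp = (\<lambda>v::complex. exp (- (of_real N * (v + 1) powr of_real \<sigma>)))"
    have R1: "R \<ge> 1" using R norm_ge_zero[of v0] by linarith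
    have N: "N \<ge> 0" using A \<kappa> by (simp add: N_def)
    have norm_damp: "cmod (damp v) = exp (- (N * Re ((v + 1) powr of_real \<sigma>)))" for v
      by (simp add: damp_def)
    have "cmod (h v0 * damp v0 * (\<Prod>p\<in>S. (v0 - p) ^ m p)) \<le> (\<Prod>p\<in>S. cmod (half_disc_factor (4 * R) p v0) ^ m p)"
    proof (rule half_disc_max_principle[OF fin])
      show "Re p > 0 \<and> cmod p < 4 * R" if "p \<in> S" for p using S[OF that] R1 by auto
      show "(\<lambda>v. h v * damp v) holomorphic_on {v. Re v > 0}"
        unfolding damp_def
        by (intro holomorphic_intros hol) (auto simp: complex_nonpos_Reals_iff)
      fix v assume v: "Re v > 0" "cmod v \<le> 4 * R"
      have "cmod (v + 1) \<le> 5 * R" using norm_triangle_ineq[of v 1] v R1 by simp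
      then have "cmod (v + 1) powr \<beta> * cmod (v + 1) powr \<sigma> \<le> (5 * R) powr \<beta> * cmod (v + 1) powr \<sigma>"
        using \<beta> by (intro mult_right_mono powr_mono2) auto
      moreover have "cmod (v + 1) powr \<rho> = cmod (v + 1) powr \<beta> * cmod (v + 1) powr \<sigma>"
        by (simp add: \<beta>_def flip: powr_add)
      ultimately have "cmod (v + 1) powr \<rho> \<le> (5 * R) powr \<beta> * cmod (v + 1) powr \<sigma>" by simp
      then have "A * cmod (v + 1) powr \<rho> \<le> A * ((5 * R) powr \<beta> * cmod (v + 1) powr \<sigma>)"
        using A by (rule mult_left_mono)
      also have "\<dots> = N * (\<kappa> * cmod (v + 1) powr \<sigma>)" using \<kappa> by (simp add: N_def)
      also have "\<dots> \<le> N * Re ((v + 1) powr of_real \<sigma>)"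
        using Re_powr_ge[of "v + 1" \<sigma>] v \<sigma> N by (intro mult_left_mono) (auto simp: \<kappa>_def)
      finally have "exp (A * cmod (v + 1) powr \<rho>) \<le> exp (N * Re ((v + 1) powr of_real \<sigma>))" by simp
      with growth v(1) have "cmod (g v) \<le> exp (N * Re ((v + 1) powr of_real \<sigma>))"
        by (meson order_trans)
      then have "cmod (g v * damp v) \<le> 1"
        by (simp add: norm_mult norm_damp exp_minus divide_simps)
      then show "cmod (h v * damp v * (\<Prod>p\<in>S. (v - p) ^ m p)) \<le> 1"
        unfolding g[OF v(1)] by (simp add: mult_ac)
    qed (use v0 R R1 in auto)
    then have "cmod (g v0) * cmod (damp v0) \<le> (\<Prod>p\<in>S. cmod (half_disc_factor (4 * R) p v0) ^ m p)"
      unfolding g[OF v0(1)] by (simp add: norm_mult mult_ac)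
    also have "\<dots> \<le> (\<Prod>p\<in>S. exp (- (k * (m p * (Re p / (cmod (p + 1))\<^sup>2)))))"
    proof (intro prod_mono conjI zero_le_power norm_ge_zero)
      fix p assume p: "p \<in> S"
      have Rep: "Re p > 0" "cmod p \<le> R" using S[OF p] by auto
      let ?y = "Re p / (cmod (p + 1))\<^sup>2"
      have p1: "cmod p \<le> cmod (p + 1)" "1 \<le> cmod (p + 1)"
      proof -
        have "(cmod p)\<^sup>2 \<le> (cmod (p + 1))\<^sup>2"
          unfolding cmod_power2 using Rep by (simp add: power2_eq_square algebra_simps)
        then show "cmod p \<le> cmod (p + 1)" by (rule power2_le_imp_le) simp
        show "1 \<le> cmod (p + 1)" using complex_Re_le_cmod[of "p + 1"] Rep by simp
      qed
      have "cmod (v0 + cnj p) \<le> cmod v0 * 1 + 1 * cmod p"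
        using norm_triangle_ineq[of v0 "cnj p"] by simp
      also have "\<dots> \<le> cmod v0 * cmod (p + 1) + 1 * cmod (p + 1)"
        using p1 by (intro add_mono mult_left_mono) auto
      also have "\<dots> = (cmod v0 + 1) * cmod (p + 1)" by (simp add: distrib_right)
      finally have "(cmod (v0 + cnj p))\<^sup>2 \<le> ((cmod v0 + 1) * cmod (p + 1))\<^sup>2"
        by (intro power_mono) auto
      then have "2 * Re v0 * Re p / ((cmod v0 + 1) * cmod (p + 1))\<^sup>2 \<le> 2 * Re v0 * Re p / (cmod (v0 + cnj p))\<^sup>2"
        using add_cnj_nonzero[of v0 p] v0 Rep p1
        by (intro divide_left_mono mult_pos_pos zero_less_power) (auto intro: add_nonneg_pos)
      then have "2 * (k * ?y) \<le> 2 * Re v0 * Re p / (cmod (v0 + cnj p))\<^sup>2"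
        by (simp add: k_def power_mult_distrib mult_ac)
      then have "(cmod (half_disc_factor (4 * R) p v0))\<^sup>2 \<le> 1 + - (2 * (k * ?y))"
        using half_disc_factor_upper_bound[of v0 R p] v0 R Rep by simp
      also have "\<dots> \<le> exp (- (2 * (k * ?y)))" by (rule exp_ge_add_one_self)
      also have "\<dots> = (exp (- (k * ?y)))\<^sup>2" by (simp flip: exp_double)
      finally have "cmod (half_disc_factor (4 * R) p v0) \<le> exp (- (k * ?y))"
        by (rule power2_le_imp_le) simp
      then have "cmod (half_disc_factor (4 * R) p v0) ^ m p \<le> exp (- (k * ?y)) ^ m p"
        by (intro power_mono) auto
      also have "\<dots> = exp (- (k * (m p * ?y)))" by (simp flip: exp_of_nat_mult add: mult_ac)
      finally show "cmod (half_disc_factor (4 * R) p v0) ^ m p \<le> exp (- (k * (m p * ?y)))" .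
    qed
    also have "\<dots> = exp (- (k * (\<Sum>p\<in>S. m p * (Re p / (cmod (p + 1))\<^sup>2))))"
      using fin by (simp add: exp_sum[symmetric] sum_negf sum_distrib_left)
    finally have "exp (ln (cmod (g v0)) - N * Re ((v0 + 1) powr of_real \<sigma>))
        \<le> exp (- (k * (\<Sum>p\<in>S. m p * (Re p / (cmod (p + 1))\<^sup>2))))"
      using v0 by (simp add: norm_damp exp_diff exp_minus divide_inverse)
    then have "k * (\<Sum>p\<in>S. m p * (Re p / (cmod (p + 1))\<^sup>2)) \<le> N * Re ((v0 + 1) powr of_real \<sigma>) - ln (cmod (g v0))"
      by simp
    also have "N * Re ((v0 + 1) powr of_real \<sigma>) \<le> N * w"
    proof -
      have "Re ((v0 + 1) powr of_real \<sigma>) \<le> cmod ((v0 + 1) powr of_real \<sigma>)" by (rule complex_Re_le_cmod)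
      also have "\<dots> = w" by (cases "v0 + 1 = 0") (simp_all add: w_def powr_def)
      finally show ?thesis using N by (rule mult_left_mono)
    qed
    also have "N * w - ln (cmod (g v0)) \<le> A * 5 powr \<beta> / \<kappa> * w * R powr \<beta> + \<bar>ln (cmod (g v0))\<bar> * R powr \<beta>"
    proof -
      have "\<bar>ln (cmod (g v0))\<bar> * 1 \<le> \<bar>ln (cmod (g v0))\<bar> * R powr \<beta>"
        using R1 \<beta> by (intro mult_left_mono) (auto simp: ge_one_powr_ge_zero)
      moreover have "N * w = A * 5 powr \<beta> / \<kappa> * w * R powr \<beta>"
        using R1 by (simp add: N_def powr_mult mult_ac)
      ultimately show ?thesis by linarith
    qed
    also have "\<dots> = k * (C * R powr \<beta>)" using k by (simp add: C_def distrib_right)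
    finally show ?thesis using k by simp
  qed
  show ?thesis
    unfolding \<beta>_def[symmetric] by (intro exI[of _ C] conjI C allI impI, rule *) blast+
qed

section \<open>Zeros in the disc away from a boundary point\<close>

text \<open>
  The quotient has removable singularities at the points of \<open>S\<close>, where \<open>zor_poly\<close> supplies the value.
\<close>
lemma factor_out_finitely_many_zeros:
  assumes f: "f holomorphic_on D" and D: "open D" "connected D"
    and nz: "\<exists>z\<in>D. f z \<noteq> 0" and S: "finite S" "S \<subseteq> D"
  shows "\<exists>h. h holomorphic_on D \<and> (\<forall>z\<in>D. f z = h z * (\<Prod>p\<in>S. (z - p) ^ nat (zorder f p)))"
proof -
  define P where "P = (\<lambda>T z. \<Prod>p\<in>T. (z - p) ^ nat (zorder f p))"
  have P_nz: "P T z \<noteq> 0" if "finite T" "z \<notin> T" for T z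
    using that by (auto simp: P_def)
  have P_hol: "P T holomorphic_on U" for T U
    unfolding P_def by (intro holomorphic_intros)
  have P_split: "P S z = (z - p) ^ nat (zorder f p) * P (S - {p}) z" if "p \<in> S" for p z
    unfolding P_def using S(1) that by (simp add: prod.remove)
  define h where "h = (\<lambda>z. if z \<in> S then zor_poly f z z / P (S - {z}) z else f z / P S z)"
  have local: "\<exists>r>0. cball p r \<subseteq> D \<and> zor_poly f p holomorphic_on cball p r \<and>
      (\<forall>w\<in>cball p r. f w = zor_poly f p w * (w - p) ^ nat (zorder f p) \<and> zor_poly f p w \<noteq> 0)"
    if "p \<in> D" for p
    using zorder_exist_zero[OF f D that nz] by auto
  have diff: "h field_differentiable at z" if z: "z \<in> D" for z
  proof -
    have "\<exists>U k. open U \<and> z \<in> U \<and> k holomorphic_on U \<and> (\<forall>w\<in>U. h w = k w)"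
    proof (cases "z \<in> S")
      case False
      show ?thesis
      proof (intro exI conjI ballI)
        show "open (D - S)" using D S finite_imp_closed by blast
        show "z \<in> D - S" using z False by simp
        show "(\<lambda>w. f w / P S w) holomorphic_on D - S"
          using P_nz S by (intro holomorphic_on_divide P_hol holomorphic_on_subset[OF f]) auto
        show "h w = f w / P S w" if "w \<in> D - S" for w using that by (simp add: h_def)
      qed
    next
      case True
      obtain r where r: "r > 0" "zor_poly f z holomorphic_on cball z r"
        "\<And>w. w \<in> cball z r \<Longrightarrow> f w = zor_poly f z w * (w - z) ^ nat (zorder f z)"
        using local[OF z] by blast
      let ?U = "ball z r - (S - {z})"
      show ?thesis
      proof (intro exI conjI ballI)
        show "open ?U" using S by (intro open_Diff finite_imp_closed) auto
        show "z \<in> ?U" using r by simp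
        show "(\<lambda>w. zor_poly f z w / P (S - {z}) w) holomorphic_on ?U"
          using P_nz S by (intro holomorphic_on_divide P_hol holomorphic_on_subset[OF r(2)]) auto
        show "h w = zor_poly f z w / P (S - {z}) w" if w: "w \<in> ?U" for w
        proof (cases "w = z")
          case False
          then have "f w / P S w = zor_poly f z w / P (S - {z}) w"
            using r(3)[of w] w P_split[OF True, of w] by simp
          then show ?thesis using False w by (simp add: h_def)
        qed (use True in \<open>simp add: h_def\<close>)
      qed
    qed
    then obtain U k where "open U" "z \<in> U" "k holomorphic_on U" "\<And>w. w \<in> U \<Longrightarrow> h w = k w" by blast
    then show ?thesis
      using holomorphic_transform[of k U h] holomorphic_on_imp_differentiable_at[of h U z] by auto
  qed
  show ?thesis
  proof (intro exI conjI ballI)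
    show "h holomorphic_on D"
      using diff by (auto simp: holomorphic_on_def intro: field_differentiable_at_within)
    show "f z = h z * (\<Prod>p\<in>S. (z - p) ^ nat (zorder f p))" if z: "z \<in> D" for z
    proof (cases "z \<in> S")
      case False
      then show ?thesis using P_nz S by (simp add: h_def P_def)
    next
      case True
      have "zor_poly f z z * (z - z) ^ nat (zorder f z) = f z" using local[OF z] by force
      moreover have "P (S - {z}) z \<noteq> 0" using P_nz S by simp
      ultimately have "f z = h z * P S z" using True P_split[OF True, of z] by (simp add: h_def)
      then show ?thesis by (simp add: P_def)
    qed
  qed
qed

lemma cayley_disc_to_half_plane:
  fixes t z :: complex
  assumes "cmod t = 1" "cmod z < 1"
  defines "v \<equiv> (t + z) / (t - z)"
  shows "Re v > 0" "cmod (v + 1) = 2 / cmod (t - z)" "t * (v - 1) / (v + 1) = z"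
    "4 * (Re v / (cmod (v + 1))\<^sup>2) = 1 - (cmod z)\<^sup>2"
proof -
  have tz: "t \<noteq> z" using assms by auto
  have t: "t \<noteq> 0" using assms by auto
  have v1: "v + 1 = 2 * t / (t - z)" using tz by (simp add: v_def field_simps)
  then show n: "cmod (v + 1) = 2 / cmod (t - z)" using assms by (simp add: norm_divide norm_mult)
  have "v - 1 = 2 * z / (t - z)" using tz by (simp add: v_def field_simps)
  then show "t * (v - 1) / (v + 1) = z" unfolding v1 using tz t by simp
  have "(Re t)\<^sup>2 + (Im t)\<^sup>2 = 1" using assms(1) cmod_power2[of t] by simp
  then have "Re v = (1 - (cmod z)\<^sup>2) / (cmod (t - z))\<^sup>2"
    unfolding v_def Re_divide cmod_power2 by (simp add: power2_eq_square algebra_simps)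
  then have Rev: "Re v * (cmod (t - z))\<^sup>2 = 1 - (cmod z)\<^sup>2" using tz by simp
  moreover have "1 - (cmod z)\<^sup>2 > 0" using assms(2) by (simp add: abs_square_less_1)
  ultimately show "Re v > 0" by (metis zero_less_mult_pos2 zero_less_norm_iff right_minus_eq tz zero_less_power)
  show "4 * (Re v / (cmod (v + 1))\<^sup>2) = 1 - (cmod z)\<^sup>2"
    using Rev n tz by (simp add: power_divide)
qed

lemma cayley_half_plane_to_disc:
  fixes t v :: complex
  assumes "cmod t = 1" "Re v > 0"
  shows "cmod (t * (v - 1) / (v + 1)) < 1" "cmod (t - t * (v - 1) / (v + 1)) = 2 / cmod (v + 1)"
proof -
  have v1: "v + 1 \<noteq> 0" using assms add_cnj_nonzero[of v 1] by simp
  have "(cmod (v - 1))\<^sup>2 < (cmod (v + 1))\<^sup>2"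
    using norm_add_cnj_sq[of v 1] assms by simp
  then have "cmod (v - 1) < cmod (v + 1)" by (rule power2_less_imp_less) simp
  then show "cmod (t * (v - 1) / (v + 1)) < 1" using assms v1 by (simp add: norm_mult norm_divide)
  have "t - t * (v - 1) / (v + 1) = 2 * t / (v + 1)" using v1 by (simp add: field_simps)
  then show "cmod (t - t * (v - 1) / (v + 1)) = 2 / cmod (v + 1)"
    using assms by (simp add: norm_mult norm_divide)
qed

text \<open>
  The half-plane inequality transported by the Cayley transform \<open>V\<close>, which sends the zeros with
  \<open>\<bar>t - p\<bar> \<ge> \<delta>\<close> into the disc of radius \<open>2 / \<delta>\<close>. The multiplicities are carried over through a
  factorization: \<open>Z v - Z w\<close> is \<open>v - w\<close> times a nonvanishing function.
\<close>
lemma disk_zeros_away_from_vertex: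
  assumes t: "cmod t = 1" and f: "f holomorphic_on ball 0 1" and nz: "\<exists>z\<in>ball 0 1. f z \<noteq> 0"
    and \<sigma>: "0 < \<sigma>" "\<sigma> < 1" "\<sigma> \<le> \<rho>" and A: "A \<ge> 0"
    and growth: "\<forall>z\<in>ball 0 1. cmod (f z) \<le> exp (A * cmod (t - z) powr (- \<rho>))"
  shows "\<exists>C\<ge>0. \<forall>\<delta> S. 0 < \<delta> \<longrightarrow> \<delta> \<le> 1 \<longrightarrow> finite S \<longrightarrow> S \<subseteq> disk_zeros f \<longrightarrow> (\<forall>p\<in>S. \<delta> \<le> cmod (t - p)) \<longrightarrow>
       (\<Sum>p\<in>S. zorder f p * (1 - cmod p)) \<le> C * \<delta> powr (\<sigma> - \<rho>)"
proof -
  define V where "V = (\<lambda>z. (t + z) / (t - z))"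
  define Z where "Z = (\<lambda>v. t * (v - 1) / (v + 1))"
  define g where "g = (\<lambda>v. f (Z v))"
  have V: "Re (V z) > 0" "cmod (V z + 1) = 2 / cmod (t - z)"
      "4 * (Re (V z) / (cmod (V z + 1))\<^sup>2) = 1 - (cmod z)\<^sup>2"
    and ZV: "Z (V z) = z" if "cmod z < 1" for z
    unfolding V_def Z_def by (rule cayley_disc_to_half_plane[OF t that])+
  have Z: "cmod (Z v) < 1" "cmod (t - Z v) = 2 / cmod (v + 1)" if "Re v > 0" for v
    unfolding Z_def by (rule cayley_half_plane_to_disc[OF t that])+
  obtain z0 where z0: "cmod z0 < 1" "f z0 \<noteq> 0" using nz by auto
  define v0 where "v0 = V z0"
  have v0: "Re v0 > 0" "g v0 \<noteq> 0" using V(1)[OF z0(1)] ZV z0 by (auto simp: v0_def g_def)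
  have v1: "v + 1 \<noteq> 0" if "Re v > 0" for v :: complex
    using that add_cnj_nonzero[of v 1] by simp
  have g_growth: "\<forall>v. Re v > 0 \<longrightarrow> cmod (g v) \<le> exp (A * cmod (v + 1) powr \<rho>)"
  proof (intro allI impI)
    fix v :: complex assume v: "Re v > 0"
    have "cmod (t - Z v) powr (- \<rho>) = (cmod (v + 1) / 2) powr \<rho>"
      unfolding Z(2)[OF v] using v1[OF v] by (simp add: powr_minus_divide powr_divide)
    also have "\<dots> \<le> cmod (v + 1) powr \<rho>" using \<sigma> by (intro powr_mono2) auto
    finally have "A * cmod (t - Z v) powr (- \<rho>) \<le> A * cmod (v + 1) powr \<rho>"
      using A by (rule mult_left_mono)
    moreover have "cmod (g v) \<le> exp (A * cmod (t - Z v) powr (- \<rho>))"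
      using growth Z(1)[OF v] by (simp add: g_def)
    ultimately show "cmod (g v) \<le> exp (A * cmod (v + 1) powr \<rho>)"
      by (meson exp_le_cancel_iff order_trans)
  qed
  from half_plane_zeros_sum_le[OF \<sigma> A v0 g_growth] obtain C where C: "C \<ge> 0"
    "\<forall>R S h (m :: complex \<Rightarrow> nat). R \<ge> cmod v0 + 1 \<longrightarrow> finite S \<longrightarrow>
       (\<forall>p\<in>S. Re p > 0 \<and> cmod p \<le> R) \<longrightarrow> h holomorphic_on {v. Re v > 0} \<longrightarrow>
       (\<forall>v. Re v > 0 \<longrightarrow> g v = h v * (\<Prod>p\<in>S. (v - p) ^ m p)) \<longrightarrow>
       (\<Sum>p\<in>S. m p * (Re p / (cmod (p + 1))\<^sup>2)) \<le> C * R powr (\<rho> - \<sigma>)"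
    by (elim exE conjE)
  define C' where "C' = 4 * C * (2 * (cmod v0 + 1)) powr (\<rho> - \<sigma>)"
  have *: "(\<Sum>p\<in>S. zorder f p * (1 - cmod p)) \<le> C' * \<delta> powr (\<sigma> - \<rho>)"
    if \<delta>: "0 < \<delta>" "\<delta> \<le> 1" and S: "finite S" "S \<subseteq> disk_zeros f"
      and far: "\<And>p. p \<in> S \<Longrightarrow> \<delta> \<le> cmod (t - p)" for \<delta> S
  proof -
    have sub: "S \<subseteq> ball 0 1" using S by (auto simp: disk_zeros_def)
    then have SD: "cmod p < 1" if "p \<in> S" for p using that by auto
    have ord: "zorder f p > 0" if "p \<in> S" for p
      using zorder_exist_zero[OF f open_ball _ _ nz, of p] S that
      by (auto simp: disk_zeros_def split: if_splits)
    obtain h where h: "h holomorphic_on ball 0 1"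
      "\<forall>z\<in>ball 0 1. f z = h z * (\<Prod>p\<in>S. (z - p) ^ nat (zorder f p))"
      using factor_out_finitely_many_zeros[OF f open_ball connected_ball nz S(1) sub] by (elim exE conjE)
    define m where "m = (\<lambda>w. nat (zorder f (Z w)))"
    define k where "k = (\<lambda>v. h (Z v) * (\<Prod>w\<in>V ` S. (2 * t / ((v + 1) * (w + 1))) ^ m w))"
    \<comment> \<open>Large enough for the zeros, and at least \<open>\<bar>v0\<bar> + 1\<close> because \<open>\<delta> \<le> 1\<close>.\<close>
    define R where "R = (cmod v0 + 1) * (2 / \<delta>)"
    have inj: "inj_on V S" using ZV SD by (metis inj_on_inverseI)
    have "(\<Sum>w\<in>V ` S. m w * (Re w / (cmod (w + 1))\<^sup>2)) \<le> C * R powr (\<rho> - \<sigma>)"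
    proof (rule C(2)[rule_format])
      have "(cmod v0 + 1) * 1 \<le> R"
        unfolding R_def using \<delta> by (intro mult_left_mono) (auto simp: field_simps)
      then show "cmod v0 + 1 \<le> R" by simp
      show "finite (V ` S)" using S by simp
      show "Re w > 0 \<and> cmod w \<le> R" if w: "w \<in> V ` S" for w
      proof -
        obtain p where p: "p \<in> S" "w = V p" using w by blast
        have Rew: "Re w > 0" using V(1)[OF SD[OF p(1)]] p by simp
        have "(cmod w)\<^sup>2 \<le> (cmod (w + 1))\<^sup>2"
          unfolding cmod_power2 using Rew by (simp add: power2_eq_square algebra_simps)
        then have "cmod w \<le> cmod (w + 1)" by (rule power2_le_imp_le) simp
        also have "\<dots> = 2 / cmod (t - p)" using V(2)[OF SD[OF p(1)]] p by simp
        also have "\<dots> \<le> 2 / \<delta>" using far[OF p(1)] \<delta> by (intro frac_le) auto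
        also have "\<dots> \<le> R"
          unfolding R_def using \<delta> mult_right_mono[of 1 "cmod v0 + 1" "2 / \<delta>"] by simp
        finally show ?thesis using Rew by simp
      qed
      show "k holomorphic_on {v. Re v > 0}"
      proof -
        have "Z holomorphic_on {v. Re v > 0}"
          unfolding Z_def using v1 by (intro holomorphic_intros) auto
        moreover have "Z ` {v. Re v > 0} \<subseteq> ball 0 1" using Z(1) by auto
        ultimately have "(h \<circ> Z) holomorphic_on {v. Re v > 0}"
          using h(1) by (meson holomorphic_on_compose_gen)
        moreover have "w + 1 \<noteq> 0" if "w \<in> V ` S" for w
          using that v1 V(1) SD by blast
        ultimately show ?thesis
          unfolding k_def o_def using v1 by (intro holomorphic_intros) auto
      qed
      show "g v = k v * (\<Prod>w\<in>V ` S. (v - w) ^ m w)" if v: "Re v > 0" for v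
      proof -
        have "g v = h (Z v) * (\<Prod>p\<in>S. (Z v - p) ^ nat (zorder f p))"
          unfolding g_def using Z(1)[OF v] by (intro h(2)[rule_format]) simp
        also have "(\<Prod>p\<in>S. (Z v - p) ^ nat (zorder f p))
            = (\<Prod>p\<in>S. (2 * t / ((v + 1) * (V p + 1)) * (v - V p)) ^ m (V p))"
        proof (rule prod.cong[OF refl])
          fix p assume p: "p \<in> S"
          have "V p + 1 \<noteq> 0" using v1 V(1)[OF SD[OF p]] by blast
          then have "Z v - Z (V p) = 2 * t / ((v + 1) * (V p + 1)) * (v - V p)"
            using v1[OF v] by (simp add: Z_def divide_simps) (simp add: algebra_simps)
          then show "(Z v - p) ^ nat (zorder f p) = (2 * t / ((v + 1) * (V p + 1)) * (v - V p)) ^ m (V p)"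
            using ZV[OF SD[OF p]] by (simp add: m_def)
        qed
        also have "\<dots> = (\<Prod>w\<in>V ` S. (2 * t / ((v + 1) * (w + 1)) * (v - w)) ^ m w)"
          by (simp add: prod.reindex[OF inj])
        also have "\<dots> = (\<Prod>w\<in>V ` S. (2 * t / ((v + 1) * (w + 1))) ^ m w) * (\<Prod>w\<in>V ` S. (v - w) ^ m w)"
          by (simp only: power_mult_distrib prod.distrib)
        finally show ?thesis by (simp only: k_def mult.assoc)
      qed
    qed
    then have "4 * (\<Sum>p\<in>S. m (V p) * (Re (V p) / (cmod (V p + 1))\<^sup>2)) \<le> 4 * (C * R powr (\<rho> - \<sigma>))"
      unfolding sum.reindex[OF inj] o_def by (rule mult_left_mono) simp
    moreover have "(\<Sum>p\<in>S. m (V p) * (4 * (Re (V p) / (cmod (V p + 1))\<^sup>2)))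
        = 4 * (\<Sum>p\<in>S. m (V p) * (Re (V p) / (cmod (V p + 1))\<^sup>2))"
      unfolding sum_distrib_left by (rule sum.cong) auto
    ultimately have "(\<Sum>p\<in>S. m (V p) * (4 * (Re (V p) / (cmod (V p + 1))\<^sup>2))) \<le> 4 * C * R powr (\<rho> - \<sigma>)"
      by linarith
    moreover have "zorder f p * (1 - cmod p) \<le> m (V p) * (4 * (Re (V p) / (cmod (V p + 1))\<^sup>2))"
      if p: "p \<in> S" for p
    proof -
      have "cmod p * cmod p \<le> cmod p" using SD[OF p] by (simp add: mult_left_le)
      then have "zorder f p * (1 - cmod p) \<le> zorder f p * (1 - (cmod p)\<^sup>2)"
        using ord[OF p] by (intro mult_left_mono) (auto simp: power2_eq_square)
      then show ?thesis using V(3)[OF SD[OF p]] ZV[OF SD[OF p]] ord[OF p] by (simp add: m_def)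
    qed
    ultimately have "(\<Sum>p\<in>S. zorder f p * (1 - cmod p)) \<le> 4 * C * R powr (\<rho> - \<sigma>)"
      by (meson order_trans sum_mono)
    also have "R powr (\<rho> - \<sigma>) = (2 * (cmod v0 + 1)) powr (\<rho> - \<sigma>) * \<delta> powr (\<sigma> - \<rho>)"
    proof -
      have "R = (2 * (cmod v0 + 1)) / \<delta>" by (simp add: R_def)
      then have "R powr (\<rho> - \<sigma>) = (2 * (cmod v0 + 1)) powr (\<rho> - \<sigma>) / \<delta> powr (\<rho> - \<sigma>)"
        using \<delta> by (simp add: powr_divide)
      also have "\<delta> powr (\<rho> - \<sigma>) = 1 / \<delta> powr (\<sigma> - \<rho>)"
        using powr_minus_divide[of \<delta> "\<sigma> - \<rho>"] by simp
      finally show ?thesis by simp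
    qed
    finally show ?thesis by (simp add: C'_def mult_ac)
  qed
  have "C' \<ge> 0" using C(1) by (simp add: C'_def)
  then show ?thesis by (intro exI[of _ C'] conjI allI impI, simp, intro *) blast+
qed

section \<open>Summation over all zeros\<close>

text \<open>
  Dyadic summation: up to the factor \<open>2 powr q\<close>, the weight \<open>d p powr q\<close> is at most the sum of
  \<open>(1/2) ^ k powr q\<close> over those \<open>k\<close> with \<open>(1/2) ^ k \<le> d p\<close>. After exchanging the sums, the \<open>k\<close>-th
  tail contributes at most \<open>C * (1/2) ^ k powr (q - \<beta>)\<close>.
\<close>
lemma weighted_sum_le_of_tail_sums:
  fixes w d :: "'a \<Rightarrow> real"
  assumes fin: "finite S" and w: "\<And>p. p \<in> S \<Longrightarrow> 0 \<le> w p" and d: "\<And>p. p \<in> S \<Longrightarrow> 0 < d p \<and> d p \<le> 2"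
    and C: "C \<ge> 0" and \<beta>: "0 \<le> \<beta>" "\<beta> < q"
    and tail: "\<And>\<delta>. 0 < \<delta> \<Longrightarrow> \<delta> \<le> 1 \<Longrightarrow> (\<Sum>p\<in>{p \<in> S. \<delta> \<le> d p}. w p) \<le> C * \<delta> powr (- \<beta>)"
  shows "(\<Sum>p\<in>S. w p * d p powr q) \<le> 2 powr q * C / (1 - (1/2) powr (q - \<beta>))"
proof -
  define I where "I = (\<lambda>k p. if (1/2) ^ k \<le> d p then 1 else 0 :: real)"
  define r where "r = (1/2) powr (q - \<beta>)"
  have r: "0 \<le> r" "r < 1"
    using \<beta> powr_less_mono'[of "1/2" 0 "q - \<beta>"] by (auto simp: r_def)
  have "\<exists>j. (1/2) ^ j \<le> d p" if "p \<in> S" for p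
    using real_arch_pow_inv[of "d p" "1/2"] d[OF that] less_imp_le by fastforce
  then obtain j where "\<And>p. p \<in> S \<Longrightarrow> (1/2) ^ j p \<le> d p" by metis
  define l where "l = (\<lambda>p. LEAST j. (1/2) ^ j \<le> d p)"
  have l: "(1/2) ^ l p \<le> d p" if "p \<in> S" for p
    unfolding l_def using \<open>p \<in> S \<Longrightarrow> (1/2) ^ j p \<le> d p\<close>[OF that] by (rule LeastI)
  have l2: "d p \<le> 2 * (1/2) ^ l p" if "p \<in> S" for p
  proof (cases "l p")
    case 0
    then show ?thesis using d[OF that] by simp
  next
    case (Suc i)
    then have "\<not> (1/2) ^ i \<le> d p" using not_less_Least[of i "\<lambda>j. (1/2) ^ j \<le> d p"] by (simp add: l_def)
    then show ?thesis using Suc by simp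
  qed
  define n where "n = Suc (Max (l ` S))"
  have ln: "l p < n" if "p \<in> S" for p using fin that by (simp add: n_def less_Suc_eq_le)
  have powk: "((1/2) ^ k) powr x = ((1/2) powr x) ^ k" for k :: nat and x :: real
    by (induction k) (simp_all only: power_0 power_Suc powr_one_eq_one powr_mult)
  have pt: "w p * d p powr q \<le> w p * (2 powr q * (\<Sum>k<n. ((1/2) ^ k) powr q * I k p))" if p: "p \<in> S" for p
  proof (intro mult_left_mono w p)
    have "d p powr q \<le> (2 * (1/2) ^ l p) powr q"
      using l2[OF p] d[OF p] \<beta> by (intro powr_mono2) auto
    also have "\<dots> = 2 powr q * (((1/2) ^ l p) powr q * I (l p) p)"
      using l[OF p] by (simp add: powr_mult I_def)
    also have "\<dots> \<le> 2 powr q * (\<Sum>k<n. ((1/2) ^ k) powr q * I k p)"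
      using ln[OF p] by (intro mult_left_mono member_le_sum) (auto simp: I_def)
    finally show "d p powr q \<le> 2 powr q * (\<Sum>k<n. ((1/2) ^ k) powr q * I k p)" .
  qed
  have "(\<Sum>p\<in>S. w p * d p powr q) \<le> (\<Sum>p\<in>S. w p * (2 powr q * (\<Sum>k<n. ((1/2) ^ k) powr q * I k p)))"
    by (rule sum_mono) (rule pt)
  also have "\<dots> = (\<Sum>p\<in>S. \<Sum>k<n. 2 powr q * (((1/2) ^ k) powr q * (w p * I k p)))"
    by (simp add: sum_distrib_left mult_ac)
  also have "\<dots> = (\<Sum>k<n. \<Sum>p\<in>S. 2 powr q * (((1/2) ^ k) powr q * (w p * I k p)))"
    by (rule sum.swap)
  also have "\<dots> = 2 powr q * (\<Sum>k<n. ((1/2) ^ k) powr q * (\<Sum>p\<in>S. w p * I k p))"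
    by (simp add: sum_distrib_left)
  also have "\<dots> \<le> 2 powr q * (\<Sum>k<n. C * r ^ k)"
  proof (intro mult_left_mono sum_mono)
    fix k
    have "(\<Sum>p\<in>S. w p * I k p) = (\<Sum>p\<in>{p \<in> S. (1/2) ^ k \<le> d p}. w p)"
      using fin by (simp add: I_def sum.inter_filter if_distrib cong: if_cong)
    also have "\<dots> \<le> C * ((1/2) ^ k) powr (- \<beta>)"
      by (rule tail) (auto simp: power_le_one)
    finally have "((1/2) ^ k) powr q * (\<Sum>p\<in>S. w p * I k p) \<le> ((1/2) ^ k) powr q * (C * ((1/2) ^ k) powr (- \<beta>))"
      by (intro mult_left_mono) auto
    also have "\<dots> = C * (((1/2) ^ k) powr q * ((1/2) ^ k) powr (- \<beta>))" by simp
    also have "\<dots> = C * r ^ k"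
      by (simp add: r_def powk[symmetric] flip: powr_add)
    finally show "((1/2) ^ k) powr q * (\<Sum>p\<in>S. w p * I k p) \<le> C * r ^ k" .
  qed auto
  also have "\<dots> = 2 powr q * C * (\<Sum>k<n. r ^ k)" by (simp add: sum_distrib_left mult.assoc)
  also have "\<dots> \<le> 2 powr q * C * (1 / (1 - r))"
  proof (intro mult_left_mono)
    have "(\<Sum>k<n. r ^ k) \<le> (\<Sum>k. r ^ k)"
      using r by (intro sum_le_suminf summable_geometric) auto
    then show "(\<Sum>k<n. r ^ k) \<le> 1 / (1 - r)" using r by (simp add: suminf_geometric)
  qed (use C in auto)
  finally show ?thesis by (simp add: r_def)
qed

theorem corollary4:
  fixes t :: complex and \<rho> K :: real and a :: "nat \<Rightarrow> complex"
  assumes "t \<in> sphere 0 1" and "\<rho> > 0" and "K > 0"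
    and "blaschke_seq a"
    and "range a \<subseteq> stolz_angle (exp_gauge \<rho>) t K"
  shows "\<forall>\<epsilon>>0. (\<lambda>z. real_of_int (zorder (deriv (blaschke_prod a)) z)
                  * ((1 - cmod z) * cmod (t - z) powr max (\<rho> - 1 + \<epsilon>) 0))
             summable_on disk_zeros (deriv (blaschke_prod a))"
proof (intro allI impI)
  fix \<epsilon> :: real assume \<epsilon>: "\<epsilon> > 0"
  define f where "f = deriv (blaschke_prod a)"
  define q where "q = max (\<rho> - 1 + \<epsilon>) 0"
  define \<sigma> where "\<sigma> = (if \<rho> < 1 then \<rho> else max (1 - \<epsilon> / 2) (1 / 2))"
  define F where "F = (\<lambda>z. real_of_int (zorder f z) * ((1 - cmod z) * cmod (t - z) powr q))"
  have t: "cmod t = 1" using assms(1) by simp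
  have \<sigma>: "0 < \<sigma>" "\<sigma> < 1" "\<sigma> \<le> \<rho>" using assms(2) \<epsilon> by (auto simp: \<sigma>_def)
  have q: "\<rho> - \<sigma> < q \<or> (q = 0 \<and> \<sigma> = \<rho>)"
    using assms(2) \<epsilon> by (auto simp: \<sigma>_def q_def max_def)
  have f: "f holomorphic_on ball 0 1"
    unfolding f_def using holomorphic_blaschke_prod[OF assms(4)] by (intro holomorphic_deriv) auto
  have nz: "\<exists>z\<in>ball 0 1. f z \<noteq> 0"
    using deriv_blaschke_prod_not_identically_0[OF assms(4)] unfolding f_def by (metis mem_ball_0)
  obtain A where A: "A \<ge> 0" "\<forall>z\<in>ball 0 1. cmod (f z) \<le> exp (A * cmod (t - z) powr (- \<rho>))"
    using deriv_blaschke_prod_growth[OF t assms(2-5), folded f_def] by (elim exE conjE)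
  from disk_zeros_away_from_vertex[OF t f nz \<sigma> A] obtain C where C: "C \<ge> 0"
    "\<forall>\<delta> S. 0 < \<delta> \<longrightarrow> \<delta> \<le> 1 \<longrightarrow> finite S \<longrightarrow> S \<subseteq> disk_zeros f \<longrightarrow> (\<forall>p\<in>S. \<delta> \<le> cmod (t - p)) \<longrightarrow>
       (\<Sum>p\<in>S. zorder f p * (1 - cmod p)) \<le> C * \<delta> powr (\<sigma> - \<rho>)"
    by (elim exE conjE)
  have ord: "zorder f p > 0" if "p \<in> disk_zeros f" for p
    using zorder_exist_zero[OF f open_ball _ _ nz, of p] that
    by (auto simp: disk_zeros_def split: if_splits)
  have dist: "0 < cmod (t - p) \<and> cmod (t - p) \<le> 2" if "p \<in> disk_zeros f" for p
    using that t norm_triangle_ineq4[of t p] by (auto simp: disk_zeros_def)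
  have w: "0 \<le> zorder f p * (1 - cmod p)" if "p \<in> disk_zeros f" for p
    using ord[OF that] that by (auto simp: disk_zeros_def)
  have "\<exists>M. \<forall>S. finite S \<longrightarrow> S \<subseteq> disk_zeros f \<longrightarrow> sum F S \<le> M"
  proof (cases "\<rho> - \<sigma> < q")
    case True
    have "sum F S \<le> 2 powr q * C / (1 - (1/2) powr (q - (\<rho> - \<sigma>)))"
      if S: "finite S" "S \<subseteq> disk_zeros f" for S
    proof -
      have tail: "(\<Sum>p\<in>{p \<in> S. \<delta> \<le> cmod (t - p)}. zorder f p * (1 - cmod p)) \<le> C * \<delta> powr (- (\<rho> - \<sigma>))"
        if "0 < \<delta>" "\<delta> \<le> 1" for \<delta>
      proof -
        have "(\<Sum>p\<in>{p \<in> S. \<delta> \<le> cmod (t - p)}. zorder f p * (1 - cmod p)) \<le> C * \<delta> powr (\<sigma> - \<rho>)"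
          by (rule C(2)[rule_format]) (use that S in auto)
        then show ?thesis by simp
      qed
      have nonneg: "0 \<le> zorder f p * (1 - cmod p)" and dist': "0 < cmod (t - p) \<and> cmod (t - p) \<le> 2"
        if "p \<in> S" for p
        using that S(2) w[of p] dist[of p] by blast+
      have "0 \<le> \<rho> - \<sigma>" using \<sigma> by simp
      from weighted_sum_le_of_tail_sums[where w = "\<lambda>p. zorder f p * (1 - cmod p)" and d = "\<lambda>p. cmod (t - p)",
          OF S(1) nonneg dist' C(1) this True tail]
      show ?thesis by (simp add: F_def mult.assoc)
    qed
    then show ?thesis by blast
  next
    case False
    then have q0: "q = 0" "\<sigma> = \<rho>" using q by auto
    have "sum F S \<le> C" if S: "finite S" "S \<subseteq> disk_zeros f" for S
    proof -
      \<comment> \<open>The bound does not depend on \<open>\<delta>\<close>, so any \<open>\<delta>\<close> that lets in all of \<open>S\<close> will do.\<close>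
      define \<delta> where "\<delta> = Min (insert 1 ((\<lambda>p. cmod (t - p)) ` S))"
      have \<delta>: "0 < \<delta>" unfolding \<delta>_def using S dist by (subst Min_gr_iff) auto
      have \<delta>1: "\<delta> \<le> 1" "\<And>p. p \<in> S \<Longrightarrow> \<delta> \<le> cmod (t - p)" using S by (auto simp: \<delta>_def)
      have "cmod (t - p) powr q = 1" if "p \<in> S" for p using dist[of p] S that by (auto simp: q0)
      then have "sum F S = (\<Sum>p\<in>S. zorder f p * (1 - cmod p))"
        by (intro sum.cong) (auto simp: F_def)
      also have "\<dots> \<le> C * \<delta> powr (\<sigma> - \<rho>)"
        by (rule C(2)[rule_format]) (use \<delta> \<delta>1 S in auto)
      also have "\<dots> = C" using \<delta> q0 by simp
      finally show ?thesis .
    qed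
    then show ?thesis by blast
  qed
  then obtain M where M: "\<And>S. finite S \<Longrightarrow> S \<subseteq> disk_zeros f \<Longrightarrow> sum F S \<le> M" by blast
  have "F summable_on disk_zeros f"
  proof (rule nonneg_bdd_above_summable_on)
    show "0 \<le> F p" if "p \<in> disk_zeros f" for p
      using w[OF that] unfolding F_def mult.assoc[symmetric] by simp
    show "bdd_above (sum F ` {S. S \<subseteq> disk_zeros f \<and> finite S})"
      using M by (intro bdd_aboveI[of _ M]) auto
  qed
  then show "(\<lambda>z. real_of_int (zorder (deriv (blaschke_prod a)) z)
                  * ((1 - cmod z) * cmod (t - z) powr max (\<rho> - 1 + \<epsilon>) 0))
             summable_on disk_zeros (deriv (blaschke_prod a))"
    by (simp only: F_def f_def q_def)
qed

end
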